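(* The reactive integer max-flow problem with uncertain arc capacities associated with the distance in values $d_{val}$, denoted $MF^{r}_{d_{val}}$, is solvable in polynomial time.
   Context: **Integer flows.** Let $G=(V,A)$ be a digraph with a source $s\in V$, a sink $t\in V$ and arc capacities $u_a\in\mathbb N$, $a\in A$. A feasible integer flow for $(G,s,t,u)$ is a vector $x\in\mathbb Z^A$ with $0\le x_a\le u_a$ for all $a\in A$ and inflow equal to outflow at every node of $V\setminus\{s,t\}$. The nominal (max-flow) problem asks for a feasible integer flow for $(G,s,t,u)$ maximizing the net flow leaving $s$. **Uncertainty.** Uncertainty is on the arc capacities: a scenario $\xi$ is given by arc capacities $u^\xi\in\mathbb N^A$, the rest of the data being unchanged. $X_\xi$ denotes the set of feasible integer flows (not necessarily of maximum value) for $(G,s,t,u^\xi)$. **Distance in values.** $d_{val}(x,y)=\sum_{a\in A}|x_a-y_a|$. **Reactive problem $MF^r_{d_{val}}$.** Input: the data above, a scenario $\xi$, and a given solution $x^{nom}$ of the nominal problem (a feasible integer flow for $(G,s,t,u)$). Task: minimize $d_{val}(x^r,x^{nom})$ subject to $x^r\in X_\xi$. **Convention.** Input integers are encoded in binary; solvable in polynomial time means that there is an algorithm which returns an optimal solution in time polynomial in the size of the input. *)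

theory Defs
  imports
    "Graph_Theory.Digraph"
    "HOL-Library.Log_Nat"
    "HOL-Computational_Algebra.Polynomial"
begin

section \<open>Random access programs under the logarithmic cost criterion\<close>

text \<open>
  The model of computation is the random access machine over the natural numbers with the
  logarithmic cost criterion, in structured form: programs are while programs, and the memory is
  divided into arrays of unbounded length. A program mentions only finitely many arrays, each under
  a fixed number (arrays cannot be addressed indirectly; cells within an array can), and it
  can use cell \<open>0\<close> of an array as a register. Every value that is computed or used as an address is
  charged its number of binary digits, so running times are polynomially related to those of
  Turing machines.
\<close>

type_synonym store = "nat \<Rightarrow> nat \<Rightarrow> nat"

datatype expr =
    Const nat
  | Load nat expr
  | Plus expr expr
  | Minus expr expr
  | Times expr expr
  | Divide expr expr

datatype com =
    Skip
  | Store nat expr expr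
  | Seq com com
  | Cond expr com com
  | While expr com

definition bits :: "nat \<Rightarrow> nat" where
  "bits n = max 1 (floorlog 2 n)"

text \<open>Subtraction is truncated at \<open>0\<close>, and division by \<open>0\<close> yields \<open>0\<close>.\<close>

fun val :: "expr \<Rightarrow> store \<Rightarrow> nat" where
  "val (Const n) \<sigma> = n"
| "val (Load a e) \<sigma> = \<sigma> a (val e \<sigma>)"
| "val (Plus e1 e2) \<sigma> = val e1 \<sigma> + val e2 \<sigma>"
| "val (Minus e1 e2) \<sigma> = val e1 \<sigma> - val e2 \<sigma>"
| "val (Times e1 e2) \<sigma> = val e1 \<sigma> * val e2 \<sigma>"
| "val (Divide e1 e2) \<sigma> = val e1 \<sigma> div val e2 \<sigma>"

fun cost :: "expr \<Rightarrow> store \<Rightarrow> nat" where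
  "cost (Const n) \<sigma> = bits n"
| "cost (Load a e) \<sigma> = cost e \<sigma> + bits (val (Load a e) \<sigma>)"
| "cost (Plus e1 e2) \<sigma> = cost e1 \<sigma> + cost e2 \<sigma> + bits (val (Plus e1 e2) \<sigma>)"
| "cost (Minus e1 e2) \<sigma> = cost e1 \<sigma> + cost e2 \<sigma> + bits (val (Minus e1 e2) \<sigma>)"
| "cost (Times e1 e2) \<sigma> = cost e1 \<sigma> + cost e2 \<sigma> + bits (val (Times e1 e2) \<sigma>)"
| "cost (Divide e1 e2) \<sigma> = cost e1 \<sigma> + cost e2 \<sigma> + bits (val (Divide e1 e2) \<sigma>)"

text \<open>
  \<open>exec c \<sigma> \<tau> \<sigma>'\<close>: started in store \<open>\<sigma>\<close>, the program \<open>c\<close> terminates in store \<open>\<sigma>'\<close> after time \<open>\<tau>\<close>.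
  A condition is true iff its value is nonzero.
\<close>

inductive exec :: "com \<Rightarrow> store \<Rightarrow> nat \<Rightarrow> store \<Rightarrow> bool" where
  Skip: "exec Skip \<sigma> 1 \<sigma>"
| Store: "exec (Store a i e) \<sigma> (1 + cost i \<sigma> + cost e \<sigma>)
            (\<sigma>(a := (\<sigma> a)(val i \<sigma> := val e \<sigma>)))"
| Seq: "exec c1 \<sigma> \<tau>1 \<sigma>1 \<Longrightarrow> exec c2 \<sigma>1 \<tau>2 \<sigma>2 \<Longrightarrow>
    exec (Seq c1 c2) \<sigma> (\<tau>1 + \<tau>2) \<sigma>2"
| CondTrue: "val b \<sigma> \<noteq> 0 \<Longrightarrow> exec c1 \<sigma> \<tau> \<sigma>' \<Longrightarrow> exec (Cond b c1 c2) \<sigma> (1 + cost b \<sigma> + \<tau>) \<sigma>'"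
| CondFalse: "val b \<sigma> = 0 \<Longrightarrow> exec c2 \<sigma> \<tau> \<sigma>' \<Longrightarrow> exec (Cond b c1 c2) \<sigma> (1 + cost b \<sigma> + \<tau>) \<sigma>'"
| WhileTrue: "val b \<sigma> \<noteq> 0 \<Longrightarrow> exec c \<sigma> \<tau>1 \<sigma>1 \<Longrightarrow> exec (While b c) \<sigma>1 \<tau>2 \<sigma>2 \<Longrightarrow>
    exec (While b c) \<sigma> (1 + cost b \<sigma> + \<tau>1 + \<tau>2) \<sigma>2"
| WhileFalse: "val b \<sigma> = 0 \<Longrightarrow> exec (While b c) \<sigma> (1 + cost b \<sigma>) \<sigma>"

inductive_cases exec_SkipE: "exec Skip \<sigma> \<tau> \<sigma>'"
inductive_cases exec_StoreE: "exec (Store a i e) \<sigma> \<tau> \<sigma>'"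
inductive_cases exec_SeqE: "exec (Seq c1 c2) \<sigma> \<tau> \<sigma>'"
inductive_cases exec_CondE: "exec (Cond b c1 c2) \<sigma> \<tau> \<sigma>'"
inductive_cases exec_WhileE: "exec (While b c) \<sigma> \<tau> \<sigma>'"

lemma exec_deterministic:
  "exec c \<sigma> \<tau> \<sigma>' \<Longrightarrow> exec c \<sigma> \<tau>' \<sigma>'' \<Longrightarrow> \<tau>' = \<tau> \<and> \<sigma>'' = \<sigma>'"
proof (induction arbitrary: \<tau>' \<sigma>'' rule: exec.induct)
  case Skip
  then show ?case by (auto elim: exec_SkipE)
next
  case Store
  then show ?case by (auto elim: exec_StoreE)
next
  case (Seq c1 \<sigma> \<tau>1 \<sigma>1 c2 \<tau>2 \<sigma>2)
  from Seq.prems obtain \<rho>1 \<rho> \<rho>2 where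
    "exec c1 \<sigma> \<rho>1 \<rho>" "exec c2 \<rho> \<rho>2 \<sigma>''" "\<tau>' = \<rho>1 + \<rho>2"
    by (rule exec_SeqE)
  with Seq.IH show ?case by metis
next
  case CondTrue
  from CondTrue.prems CondTrue.hyps show ?case by (auto elim!: exec_CondE dest!: CondTrue.IH)
next
  case CondFalse
  from CondFalse.prems CondFalse.hyps show ?case by (auto elim!: exec_CondE dest!: CondFalse.IH)
next
  case (WhileTrue b \<sigma> c \<tau>1 \<sigma>1 \<tau>2 \<sigma>2)
  from WhileTrue.prems WhileTrue.hyps(1) obtain \<rho>1 \<rho> \<rho>2 where
    "exec c \<sigma> \<rho>1 \<rho>" "exec (While b c) \<rho> \<rho>2 \<sigma>''" "\<tau>' = 1 + cost b \<sigma> + \<rho>1 + \<rho>2"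
    by (auto elim: exec_WhileE)
  with WhileTrue.IH show ?case by metis
next
  case (WhileFalse b \<sigma> c)
  from WhileFalse.prems WhileFalse.hyps show ?case
    by (rule_tac exec_WhileE[of b c \<sigma> \<tau>' \<sigma>'']) auto
qed


section \<open>Polynomial-time solvability\<close>

definition input_size :: "nat list \<Rightarrow> nat" where
  "input_size xs = (\<Sum>x\<leftarrow>xs. bits x)"

text \<open>The input is placed in array \<open>0\<close>; all other cells are initially \<open>0\<close>.\<close>

definition init_store :: "nat list \<Rightarrow> store" where
  "init_store xs = (\<lambda>a i. if a = 0 \<and> i < length xs then xs ! i else 0)"

text \<open>
  A problem is given by its set of instances, their encoding as sequences of natural numbers,
  and the relation between instances and correct outputs. The output is read from array \<open>1\<close>.
\<close>

definition polynomial_time_solvable ::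
  "'i set \<Rightarrow> ('i \<Rightarrow> nat list) \<Rightarrow> ('i \<Rightarrow> (nat \<Rightarrow> nat) \<Rightarrow> bool) \<Rightarrow> bool" where
  "polynomial_time_solvable Inst enc correct \<longleftrightarrow>
     (\<exists>(c :: com) (p :: nat poly). \<forall>I\<in>Inst. \<exists>\<tau> \<sigma>.
        exec c (init_store (enc I)) \<tau> \<sigma> \<and>
        \<tau> \<le> poly p (input_size (enc I)) \<and>
        correct I (\<sigma> 1))"


section \<open>Integer flows\<close>

definition feasible_flows ::
  "('v, 'a) pre_digraph \<Rightarrow> 'v \<Rightarrow> 'v \<Rightarrow> ('a \<Rightarrow> nat) \<Rightarrow> ('a \<Rightarrow> int) set" where
  "feasible_flows G s t u =
     {x. (\<forall>a\<in>arcs G. 0 \<le> x a \<and> x a \<le> int (u a)) \<and>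
         (\<forall>v\<in>verts G - {s, t}. (\<Sum>a\<in>in_arcs G v. x a) = (\<Sum>a\<in>out_arcs G v. x a))}"

definition d_val :: "('v, 'a) pre_digraph \<Rightarrow> ('a \<Rightarrow> int) \<Rightarrow> ('a \<Rightarrow> int) \<Rightarrow> int" where
  "d_val G x y = (\<Sum>a\<in>arcs G. \<bar>x a - y a\<bar>)"


section \<open>The reactive integer max-flow problem\<close>

record mf_instance =
  graph :: "(nat, nat) pre_digraph"
  src :: nat
  snk :: nat
  nom_cap :: "nat \<Rightarrow> nat"
  scen_cap :: "nat \<Rightarrow> nat"
  nom_sol :: "nat \<Rightarrow> int"

text \<open>Vertices and arcs are numbered consecutively from \<open>0\<close>.\<close>

definition MF_instances :: "mf_instance set" where
  "MF_instances =
     {I. fin_digraph (graph I) \<and>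
         verts (graph I) = {..<card (verts (graph I))} \<and>
         arcs (graph I) = {..<card (arcs (graph I))} \<and>
         src I \<in> verts (graph I) \<and> snk I \<in> verts (graph I) \<and>
         nom_sol I \<in> feasible_flows (graph I) (src I) (snk I) (nom_cap I)}"

text \<open>
  The vertices are listed explicitly, so that the size of the input is at least the number of
  vertices even in the presence of isolated ones.
\<close>

definition encode_MF :: "mf_instance \<Rightarrow> nat list" where
  "encode_MF I =
     (let n = card (verts (graph I)); m = card (arcs (graph I)) in
        [n, m, src I, snk I] @ [0..<n] @
        map (tail (graph I)) [0..<m] @ map (head (graph I)) [0..<m] @
        map (nom_cap I) [0..<m] @ map (scen_cap I) [0..<m] @
        map (\<lambda>a. nat (nom_sol I a)) [0..<m])"

definition optimal_reaction :: "mf_instance \<Rightarrow> (nat \<Rightarrow> int) \<Rightarrow> bool" where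
  "optimal_reaction I x \<longleftrightarrow>
     is_arg_min (\<lambda>y. d_val (graph I) y (nom_sol I))
       (\<lambda>y. y \<in> feasible_flows (graph I) (src I) (snk I) (scen_cap I)) x"

end

theory Submission
  imports Defs
begin

text \<open>
  Identifying the sink with the source turns feasible flows into circulations, so that the task is to
  minimize \<open>\<Sum>a. \<bar>x a - y a\<bar>\<close> over circulations \<open>0 \<le> x \<le> u\<close>. We scale the bits of \<open>u\<close> and \<open>y\<close>: passing
  from \<open>u div 2D\<close>, \<open>y div 2D\<close> to \<open>u div D\<close>, \<open>y div D\<close>, a solution is doubled and violates the optimality
  conditions by at most one unit on every arc. Each phase repairs these at most \<open>m\<close> units by a push-relabel
  method with unit pushes. Arc costs are \<open>\<plusminus>1\<close>; multiplied by \<open>n + 1\<close> they make reduced costs at least \<open>-1\<close>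
  on residual arcs sufficient for optimality, and since they are small, the heights, and with them the
  number of pushes and relabels, are polynomially bounded.

  The algorithm is written with bounded loops only and without multiplication of memory contents, so
  that the number of bits in the memory grows linearly with the number of steps, and a polynomial bound
  on the number of steps suffices for the logarithmic cost.
\<close>

section \<open>Loop programs\<close>

text \<open>A push-relabel method normally stops when no node is active. With bounded loops each
  phase instead performs a number of sweeps fixed in advance, so a bound on the work must be known
  beforehand and surplus sweeps must be harmless. Heights are not reset between phases. Each phase
  raises the bound on them by \<open>n * (n + 2)\<close>, so they stay below
  \<open>L * n * (n + 2)\<close>, where \<open>L\<close> is the number of bits of the total scenario
  capacity. For the scaling factor \<open>2 ^ L\<close> all capacities vanish, which makes the zero
  flow a valid start. The factor \<open>n + 1\<close> is chosen because \<open>n\<close> nodes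
  cannot occupy all residues modulo \<open>n + 1\<close>. The free residue serves twice: as the
  origin of a rank that every push decreases, although pushes may go uphill, and as the place where
  heights can be cut into integral dual potentials without the tolerance of one being felt.\<close>

datatype prog =
    Nop
  | Asg nat expr expr
  | Sq prog prog (infixr ";;" 60)
  | Branch expr prog prog
  | Loop bool nat expr prog

fun loop_step :: "bool \<Rightarrow> nat \<Rightarrow> nat" where
  "loop_step halve k = (if halve then k div 2 else k - 1)"

fun loop_count :: "bool \<Rightarrow> nat \<Rightarrow> nat" where
  "loop_count halve k = (if halve then floorlog 2 k else k)"

definition put :: "nat \<Rightarrow> nat \<Rightarrow> nat \<Rightarrow> store \<Rightarrow> store" where
  "put a i k \<sigma> = \<sigma>(a := (\<sigma> a)(i := k))"

text \<open>The counter changes before the body runs. In a decreasing loop the body therefore sees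
  the indices \<open>k - 1\<close> down to \<open>0\<close> and can use the counter as an array
  index.\<close>

definition tick :: "bool \<Rightarrow> nat \<Rightarrow> store \<Rightarrow> store" where
  "tick halve r \<sigma> = put r 0 (loop_step halve (\<sigma> r 0)) \<sigma>"

primrec sem :: "prog \<Rightarrow> store \<Rightarrow> store" where
  "sem Nop = (\<lambda>\<sigma>. \<sigma>)"
| "sem (Asg a i e) = (\<lambda>\<sigma>. put a (val i \<sigma>) (val e \<sigma>) \<sigma>)"
| "sem (p ;; q) = (\<lambda>\<sigma>. sem q (sem p \<sigma>))"
| "sem (Branch e p q) = (\<lambda>\<sigma>. if val e \<sigma> \<noteq> 0 then sem p \<sigma> else sem q \<sigma>)"
| "sem (Loop halve r e p) = (\<lambda>\<sigma>.
     ((\<lambda>\<sigma>. sem p (tick halve r \<sigma>)) ^^ loop_count halve (val e \<sigma>)) (put r 0 (val e \<sigma>) \<sigma>))"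

definition tick_expr :: "bool \<Rightarrow> nat \<Rightarrow> expr" where
  "tick_expr halve r =
     (if halve then Divide (Load r (Const 0)) (Const 2) else Minus (Load r (Const 0)) (Const 1))"

primrec compile :: "prog \<Rightarrow> com" where
  "compile Nop = Skip"
| "compile (Asg a i e) = Store a i e"
| "compile (p ;; q) = Seq (compile p) (compile q)"
| "compile (Branch e p q) = Cond e (compile p) (compile q)"
| "compile (Loop halve r e p) =
     Seq (Store r (Const 0) e)
       (While (Load r (Const 0)) (Seq (Store r (Const 0) (tick_expr halve r)) (compile p)))"

primrec writes :: "prog \<Rightarrow> nat set" where
  "writes Nop = {}"
| "writes (Asg a i e) = {a}"
| "writes (p ;; q) = writes p \<union> writes q"
| "writes (Branch e p q) = writes p \<union> writes q"
| "writes (Loop halve r e p) = insert r (writes p)"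

text \<open>
  Multiplication is restricted to factors bounded by a constant, so that one step increases the
  number of bits in the memory by at most a constant.
\<close>

fun linear_expr :: "expr \<Rightarrow> bool" where
  "linear_expr (Const n) = True"
| "linear_expr (Load a e) = linear_expr e"
| "linear_expr (Plus e1 e2) = (linear_expr e1 \<and> linear_expr e2)"
| "linear_expr (Minus e1 e2) = (linear_expr e1 \<and> linear_expr e2)"
| "linear_expr (Times (Minus (Const c) e1) e2) = (linear_expr e1 \<and> linear_expr e2)"
| "linear_expr (Times e1 e2) = False"
| "linear_expr (Divide e1 e2) = (linear_expr e1 \<and> linear_expr e2)"

text \<open>One number for two purposes: the bits that an expression can add to those in the memory,
  and the number of charges in its cost. A constant \<open>n\<close> counts as \<open>n + 1\<close>,
  which is at least its number of bits.\<close>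

primrec growth :: "expr \<Rightarrow> nat" where
  "growth (Const n) = n + 1"
| "growth (Load a e) = growth e + 1"
| "growth (Plus e1 e2) = growth e1 + growth e2 + 1"
| "growth (Minus e1 e2) = growth e1 + growth e2 + 1"
| "growth (Times e1 e2) = growth e1 + growth e2 + 1"
| "growth (Divide e1 e2) = growth e1 + growth e2 + 1"

primrec well_formed :: "nat \<Rightarrow> prog \<Rightarrow> bool" where
  "well_formed G Nop = True"
| "well_formed G (Asg a i e) = (linear_expr i \<and> linear_expr e \<and> growth i \<le> G \<and> growth e \<le> G)"
| "well_formed G (p ;; q) = (well_formed G p \<and> well_formed G q)"
| "well_formed G (Branch e p q) = (linear_expr e \<and> growth e \<le> G \<and> well_formed G p \<and> well_formed G q)"
| "well_formed G (Loop halve r e p) =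
     (linear_expr e \<and> growth e \<le> G \<and> r \<notin> writes p \<and> well_formed G p)"

primrec loops_bounded :: "nat \<Rightarrow> prog \<Rightarrow> store \<Rightarrow> bool" where
  "loops_bounded B Nop = (\<lambda>\<sigma>. True)"
| "loops_bounded B (Asg a i e) = (\<lambda>\<sigma>. True)"
| "loops_bounded B (p ;; q) = (\<lambda>\<sigma>. loops_bounded B p \<sigma> \<and> loops_bounded B q (sem p \<sigma>))"
| "loops_bounded B (Branch e p q) =
     (\<lambda>\<sigma>. if val e \<sigma> \<noteq> 0 then loops_bounded B p \<sigma> else loops_bounded B q \<sigma>)"
| "loops_bounded B (Loop halve r e p) = (\<lambda>\<sigma>.
     loop_count halve (val e \<sigma>) \<le> B \<and>
     (\<forall>i<loop_count halve (val e \<sigma>). loops_bounded B p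
        (tick halve r (((\<lambda>\<sigma>. sem p (tick halve r \<sigma>)) ^^ i) (put r 0 (val e \<sigma>) \<sigma>)))))"

text \<open>The argument of the polynomial is a bound on the number of iterations of each loop.\<close>

primrec steps :: "prog \<Rightarrow> nat poly" where
  "steps Nop = 1"
| "steps (Asg a i e) = 1"
| "steps (p ;; q) = steps p + steps q"
| "steps (Branch e p q) = 1 + steps p + steps q"
| "steps (Loop halve r e p) = 2 + [:0, 1:] * (steps p + 2)"

section \<open>Running time from step counts and bit growth\<close>

lemma sem_frame: "a \<notin> writes p \<Longrightarrow> sem p \<sigma> a = \<sigma> a"
proof (induction p arbitrary: \<sigma>)
  case (Loop halve r e p)
  have "(((\<lambda>\<sigma>. sem p (tick halve r \<sigma>)) ^^ i) \<sigma>') a = \<sigma>' a" for i \<sigma>'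
    using Loop by (induction i) (auto simp: tick_def put_def)
  then show ?case
    using Loop.prems by (simp add: put_def)
qed (auto simp: put_def)

lemma bits_le: "n < 2 ^ k \<Longrightarrow> 0 < k \<Longrightarrow> bits n \<le> k"
  by (simp add: bits_def floorlog_leI)

lemma less_bits: "n < 2 ^ bits n"
  using floorlog_leD[of 2 n "bits n"] by (simp add: bits_def)

lemma add_less_two_power:
  fixes x y :: nat
  assumes "x < 2 ^ j" "y < 2 ^ k"
  shows "x + y < 2 ^ (j + k)"
proof -
  obtain A where A: "(2::nat) ^ j = Suc A" by (metis gr0_conv_Suc zero_less_numeral zero_less_power)
  obtain B where B: "(2::nat) ^ k = Suc B" by (metis gr0_conv_Suc zero_less_numeral zero_less_power)
  show ?thesis using assms unfolding power_add A B by simp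
qed

text \<open>A sum needs at most one more bit, and the factor \<open>c - _\<close> of a product is
  below \<open>2 ^ c\<close>, so it adds at most \<open>c\<close> bits. Free products could double
  the number of bits in every step.\<close>

lemma linear_bound:
  assumes "\<forall>a i. \<sigma> a i < 2 ^ b" "linear_expr e"
  shows "val e \<sigma> < 2 ^ (b + growth e) \<and> cost e \<sigma> \<le> growth e * (b + growth e)"
  using assms(2)
proof (induction e rule: linear_expr.induct)
  case (1 n)
  have v: "n < 2 ^ (n + 1)" by (rule less_trans[OF less_exp]) simp
  also have "(2::nat) ^ (n + 1) \<le> 2 ^ (b + (n + 1))" by (intro power_increasing) auto
  finally have "n < 2 ^ (b + (n + 1))" .
  then have "bits n \<le> b + (n + 1)" by (intro bits_le) auto
  then show ?case using \<open>n < 2 ^ (b + (n + 1))\<close>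
    by (simp add: algebra_simps)
next
  case (2 a e)
  have v: "\<sigma> a (val e \<sigma>) < 2 ^ (b + (growth e + 1))"
    by (rule less_le_trans[OF assms(1)[rule_format]]) (rule power_increasing; simp)
  then have "bits (\<sigma> a (val e \<sigma>)) \<le> b + (growth e + 1)" by (intro bits_le) auto
  then show ?case using 2 v by (simp add: algebra_simps)
next
  case (3 e1 e2)
  let ?k = "b + growth (Plus e1 e2)"
  have "val e1 \<sigma> < 2 ^ (b + growth e1 + growth e2)"
    by (rule less_le_trans[OF _ power_increasing[of "b + growth e1"]]) (use 3 in auto)
  moreover have "val e2 \<sigma> < 2 ^ (b + growth e1 + growth e2)"
    by (rule less_le_trans[OF _ power_increasing[of "b + growth e2"]]) (use 3 in auto)
  ultimately have v: "val (Plus e1 e2) \<sigma> < 2 ^ ?k"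
    by (simp add: add.assoc[symmetric])
  have "bits (val (Plus e1 e2) \<sigma>) \<le> ?k"
    by (rule bits_le[OF v]) simp
  with 3 v show ?case by (simp add: algebra_simps)
next
  case (4 e1 e2)
  let ?k = "b + growth (Minus e1 e2)"
  have "val e1 \<sigma> < 2 ^ ?k"
    by (rule less_le_trans[OF _ power_increasing[of "b + growth e1"]]) (use 4 in auto)
  then have v: "val (Minus e1 e2) \<sigma> < 2 ^ ?k"
    by simp
  have "bits (val (Minus e1 e2) \<sigma>) \<le> ?k"
    by (rule bits_le[OF v]) simp
  with 4 v show ?case by (simp add: algebra_simps)
next
  case (5 c e1 e2)
  let ?m = "Minus (Const c) e1"
  let ?k = "b + growth (Times ?m e2)"
  have "val ?m \<sigma> < 2 ^ c"
    by (rule le_less_trans[of _ c]) (auto simp: less_exp)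
  moreover have "val e2 \<sigma> < 2 ^ (b + growth e2)"
    using 5 by auto
  ultimately have "val (Times ?m e2) \<sigma> < 2 ^ c * 2 ^ (b + growth e2)"
    by (simp only: val.simps mult_strict_mono' zero_le)
  also have "\<dots> = 2 ^ (c + (b + growth e2))"
    by (simp add: power_add)
  also have "\<dots> \<le> 2 ^ ?k"
    by (rule power_increasing) auto
  finally have v: "val (Times ?m e2) \<sigma> < 2 ^ ?k" .
  have t: "bits (val (Times ?m e2) \<sigma>) \<le> ?k"
    by (rule bits_le[OF v]) simp
  have "c < 2 ^ (c + 1)" by (rule less_trans[OF less_exp]) simp
  also have "(2::nat) ^ (c + 1) \<le> 2 ^ (b + c + 1)" by (intro power_increasing) auto
  finally have c: "c < 2 ^ (b + c + 1)" .
  have "c - val e1 \<sigma> < 2 ^ (b + c + 1)" using c by simp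
  then have "bits (c - val e1 \<sigma>) \<le> b + c + 1" by (intro bits_le) auto
  moreover have "bits c \<le> b + c + 1" using c by (intro bits_le) auto
  moreover have "cost e1 \<sigma> \<le> growth e1 * (b + growth e1)" "cost e2 \<sigma> \<le> growth e2 * (b + growth e2)"
    using 5 by auto
  ultimately have "cost (Times ?m e2) \<sigma> \<le>
      (b + c + 1) + growth e1 * (b + growth e1) + (b + c + 1) + growth e2 * (b + growth e2) + ?k"
    using t by simp
  also have "\<dots> \<le> growth (Times ?m e2) * ?k"
    by (simp add: algebra_simps)
  finally show ?case using v by simp
next
  case ("7" e1 e2)
  let ?k = "b + growth (Divide e1 e2)"
  have "val e1 \<sigma> < 2 ^ ?k"
    by (rule less_le_trans[OF _ power_increasing[of "b + growth e1"]]) (use 7 in auto)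
  then have v: "val (Divide e1 e2) \<sigma> < 2 ^ ?k"
    by (simp add: le_less_trans[OF div_le_dividend])
  have "bits (val (Divide e1 e2) \<sigma>) \<le> ?k"
    by (rule bits_le[OF v]) simp
  with 7 v show ?case by (simp add: algebra_simps)
qed auto

lemma linear_bound':
  assumes "\<forall>a i. \<sigma> a i < 2 ^ b" "linear_expr e" "growth e \<le> G"
  shows "val e \<sigma> < 2 ^ (b + G)" "cost e \<sigma> \<le> G * (b + G)"
proof -
  have *: "val e \<sigma> < 2 ^ (b + growth e)" "cost e \<sigma> \<le> growth e * (b + growth e)"
    using linear_bound[OF assms(1,2)] by auto
  show "val e \<sigma> < 2 ^ (b + G)"
    by (rule less_le_trans[OF *(1)]) (simp add: assms(3))
  show "cost e \<sigma> \<le> G * (b + G)"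
    by (rule order.trans[OF *(2)]) (intro mult_mono add_mono assms(3); simp)
qed

text \<open>A step evaluates at most two expressions, the index and the value of an assignment, each
  at a cost of at most \<open>G\<close> times the number of bits; the \<open>1\<close> is the charge
  for the statement.\<close>

definition step_cost :: "nat \<Rightarrow> nat \<Rightarrow> nat" where
  "step_cost G b = 1 + 2 * G * b"

lemma step_cost_mono: "b \<le> b' \<Longrightarrow> step_cost G b \<le> step_cost G b'"
  by (simp add: step_cost_def)

text \<open>Each of the \<open>k\<close> steps adds at most \<open>G\<close> bits. Charging all of
  them at the final number of bits keeps the estimate closed under composition.\<close>

definition runs :: "nat \<Rightarrow> nat \<Rightarrow> com \<Rightarrow> store \<Rightarrow> nat \<Rightarrow> store \<Rightarrow> bool" where
  "runs G b c \<sigma> k \<sigma>' \<longleftrightarrow>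
     (\<exists>\<tau>. exec c \<sigma> \<tau> \<sigma>' \<and> \<tau> \<le> k * step_cost G (b + G * k)) \<and> (\<forall>a i. \<sigma>' a i < 2 ^ (b + G * k))"

lemma runs_mono:
  assumes "runs G b c \<sigma> k \<sigma>'" "k \<le> k'"
  shows "runs G b c \<sigma> k' \<sigma>'"
proof -
  have "k * step_cost G (b + G * k) \<le> k' * step_cost G (b + G * k')"
    using assms(2) by (intro mult_mono step_cost_mono) auto
  moreover have "(2::nat) ^ (b + G * k) \<le> 2 ^ (b + G * k')"
    using assms(2) by (intro power_increasing) auto
  ultimately show ?thesis
    using assms(1) unfolding runs_def by (meson le_trans less_le_trans)
qed

lemma time_add:
  assumes "\<tau>1 \<le> k1 * step_cost G (b + G * k1)" "\<tau>2 \<le> k2 * step_cost G (b + G * k1 + G * k2)"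
  shows "\<tau>1 + \<tau>2 \<le> (k1 + k2) * step_cost G (b + G * (k1 + k2))"
proof -
  have "k1 * step_cost G (b + G * k1) \<le> k1 * step_cost G (b + G * (k1 + k2))"
    by (intro mult_le_mono2 step_cost_mono) simp
  moreover have "k2 * step_cost G (b + G * k1 + G * k2) = k2 * step_cost G (b + G * (k1 + k2))"
    by (simp add: algebra_simps)
  ultimately show ?thesis using assms unfolding add_mult_distrib by linarith
qed

lemma runs_Seq:
  assumes "runs G b c1 \<sigma> k1 \<sigma>1" "runs G (b + G * k1) c2 \<sigma>1 k2 \<sigma>2"
  shows "runs G b (Seq c1 c2) \<sigma> (k1 + k2) \<sigma>2"
proof -
  obtain \<tau>1 \<tau>2 where
    "exec c1 \<sigma> \<tau>1 \<sigma>1" "\<tau>1 \<le> k1 * step_cost G (b + G * k1)"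
    "exec c2 \<sigma>1 \<tau>2 \<sigma>2" "\<tau>2 \<le> k2 * step_cost G (b + G * k1 + G * k2)"
    using assms unfolding runs_def by auto
  then have "exec (Seq c1 c2) \<sigma> (\<tau>1 + \<tau>2) \<sigma>2"
    "\<tau>1 + \<tau>2 \<le> (k1 + k2) * step_cost G (b + G * (k1 + k2))"
    by (auto intro: exec.Seq time_add)
  then show ?thesis
    using assms(2) unfolding runs_def by (auto simp: algebra_simps)
qed

lemma runs_test:
  assumes "\<And>\<tau>. exec c \<sigma> \<tau> \<sigma>' \<Longrightarrow> exec c' \<sigma> (1 + cost e \<sigma> + \<tau>) \<sigma>'"
    and "runs G b c \<sigma> k \<sigma>'"
    and "\<forall>a i. \<sigma> a i < 2 ^ b" "linear_expr e" "growth e \<le> G"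
  shows "runs G b c' \<sigma> (1 + k) \<sigma>'"
proof -
  obtain \<tau> where \<tau>: "exec c \<sigma> \<tau> \<sigma>'" "\<tau> \<le> k * step_cost G (b + G * k)"
    "\<forall>a i. \<sigma>' a i < 2 ^ (b + G * k)"
    using assms(2) unfolding runs_def by auto
  have "1 + cost e \<sigma> \<le> 1 * step_cost G (b + G * 1)"
    using linear_bound'(2)[OF assms(3,4,5)] by (simp add: step_cost_def)
  moreover have "\<tau> \<le> k * step_cost G (b + G * 1 + G * k)"
    by (rule order.trans[OF \<tau>(2)]) (intro mult_mono step_cost_mono; simp)
  ultimately have "1 + cost e \<sigma> + \<tau> \<le> (1 + k) * step_cost G (b + G * (1 + k))"
    by (rule time_add)
  moreover have "\<sigma>' a i < 2 ^ (b + G * (1 + k))" for a i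
    by (rule less_le_trans[OF \<tau>(3)[rule_format]]) (rule power_increasing; simp)
  ultimately show ?thesis
    using assms(1)[OF \<tau>(1)] unfolding runs_def by blast
qed

lemma runs_Store:
  assumes "\<forall>a i. \<sigma> a i < 2 ^ b" "linear_expr i" "growth i \<le> G" "linear_expr e" "growth e \<le> G"
  shows "runs G b (Store a i e) \<sigma> 1 (put a (val i \<sigma>) (val e \<sigma>) \<sigma>)"
proof -
  have "1 + cost i \<sigma> + cost e \<sigma> \<le> 1 * step_cost G (b + G * 1)"
    using linear_bound'(2)[OF assms(1,2,3)] linear_bound'(2)[OF assms(1,4,5)]
    by (simp add: step_cost_def)
  moreover have "\<sigma> a j < 2 ^ (b + G * 1)" for a j
    by (rule less_le_trans[OF assms(1)[rule_format]]) (rule power_increasing; simp)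
  moreover have "val e \<sigma> < 2 ^ (b + G * 1)"
    using linear_bound'(1)[OF assms(1,4,5)] by simp
  ultimately show ?thesis
    unfolding runs_def put_def by (auto intro!: exI[of _ "1 + cost i \<sigma> + cost e \<sigma>"] exec.Store)
qed

lemma runs_Skip:
  assumes "\<forall>a i. \<sigma> a i < 2 ^ b"
  shows "runs G b Skip \<sigma> 1 \<sigma>"
proof -
  have "\<sigma> a j < 2 ^ (b + G * 1)" for a j
    by (rule less_le_trans[OF assms(1)[rule_format]]) (rule power_increasing; simp)
  then show ?thesis
    unfolding runs_def by (auto intro!: exI[of _ 1] exec.Skip simp: step_cost_def)
qed

lemma loop_count_pos: "0 < loop_count halve v \<longleftrightarrow> 0 < v"
  by (simp add: floorlog_def)

lemma loop_count_step: "0 < v \<Longrightarrow> loop_count halve v = Suc (loop_count halve (loop_step halve v))"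
  by (simp add: compute_floorlog[of 2 v])

text \<open>An iteration takes the \<open>k\<close> steps of the body, one for the test and one for
  the counter; the last test gives the leading \<open>1\<close>. The body is assumed for every
  \<open>b'\<close> because the memory grows from one iteration to the next. \<open>10\<close>
  covers the growth of the expressions that handle the counter.\<close>

lemma runs_While:
  assumes body: "\<And>i b'. i < loop_count halve (\<sigma> r 0) \<Longrightarrow>
      \<forall>a j. tick halve r ((f ^^ i) \<sigma>) a j < 2 ^ b' \<Longrightarrow>
      runs G b' c (tick halve r ((f ^^ i) \<sigma>)) k (f ((f ^^ i) \<sigma>))"
    and frame: "\<And>\<sigma>. f \<sigma> r = tick halve r \<sigma> r"
    and "\<forall>a i. \<sigma> a i < 2 ^ b" "10 \<le> G"
  shows "runs G b (While (Load r (Const 0)) (Seq (Store r (Const 0) (tick_expr halve r)) c)) \<sigma>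
      (1 + loop_count halve (\<sigma> r 0) * (k + 2)) ((f ^^ loop_count halve (\<sigma> r 0)) \<sigma>)"
    (is "runs G b ?W _ _ _")
  using body assms(3)
proof (induction "loop_count halve (\<sigma> r 0)" arbitrary: \<sigma> b)
  case 0
  then have "\<sigma> r 0 = 0" using loop_count_pos[of halve "\<sigma> r 0"] by simp
  then have "exec ?W \<sigma> (1 + cost (Load r (Const 0)) \<sigma>) \<sigma>"
    by (intro exec.WhileFalse) simp
  moreover have "1 + cost (Load r (Const 0)) \<sigma> \<le> 1 * step_cost G (b + G * 1)"
    using linear_bound'(2)[OF 0(3), of "Load r (Const 0)" G] \<open>10 \<le> G\<close> by (simp add: step_cost_def)
  moreover have "\<sigma> a i < 2 ^ (b + G * 1)" for a i
    by (rule less_le_trans[OF 0(3)[rule_format]]) (rule power_increasing; simp)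
  ultimately show ?case
    unfolding runs_def 0(1)[symmetric] by auto
next
  case (Suc n)
  then have pos: "\<sigma> r 0 \<noteq> 0" using loop_count_pos[of halve "\<sigma> r 0"] by simp
  have n: "n = loop_count halve (f \<sigma> r 0)"
    using Suc(2) loop_count_step[of "\<sigma> r 0" halve] pos by (simp add: frame tick_def put_def)
  have pow: "(f ^^ i) (f \<sigma>) = (f ^^ Suc i) \<sigma>" for i
    by (simp add: funpow_swap1)
  have "runs G b (Store r (Const 0) (tick_expr halve r)) \<sigma> 1 (tick halve r \<sigma>)"
    using runs_Store[OF Suc(4), of "Const 0" G "tick_expr halve r" r] \<open>10 \<le> G\<close>
    by (cases halve) (simp_all add: tick_expr_def tick_def)
  moreover have "runs G (b + G * 1) c (tick halve r \<sigma>) k (f \<sigma>)"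
  proof -
    have "\<forall>a j. tick halve r \<sigma> a j < 2 ^ (b + G * 1)"
      using calculation unfolding runs_def by auto
    then show ?thesis
      using Suc(3)[of 0 "b + G * 1"] Suc(2) by simp
  qed
  ultimately have 1: "runs G b (Seq (Store r (Const 0) (tick_expr halve r)) c) \<sigma> (1 + k) (f \<sigma>)"
    by (rule runs_Seq)
  have 2: "runs G (b + G * (1 + k)) ?W (f \<sigma>) (1 + n * (k + 2)) ((f ^^ n) (f \<sigma>))"
    unfolding n
  proof (rule Suc(1)[of "f \<sigma>", OF n])
    show "runs G b' c (tick halve r ((f ^^ i) (f \<sigma>))) k (f ((f ^^ i) (f \<sigma>)))"
      if "i < loop_count halve (f \<sigma> r 0)"
        "\<forall>a j. tick halve r ((f ^^ i) (f \<sigma>)) a j < 2 ^ b'" for i b'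
    proof -
      have "Suc i < loop_count halve (\<sigma> r 0)" using that(1) Suc(2) n by simp
      from Suc(3)[OF this, of b', unfolded pow[symmetric], OF that(2)] show ?thesis .
    qed
    show "\<forall>a i. f \<sigma> a i < 2 ^ (b + G * (1 + k))"
      using 1 unfolding runs_def by auto
  qed
  have "runs G b (Seq (Seq (Store r (Const 0) (tick_expr halve r)) c) ?W) \<sigma>
      ((1 + k) + (1 + n * (k + 2))) ((f ^^ n) (f \<sigma>))"
    by (rule runs_Seq[OF 1 2])
  then have "runs G b ?W \<sigma> (1 + ((1 + k) + (1 + n * (k + 2)))) ((f ^^ n) (f \<sigma>))"
  proof (rule runs_test[rotated])
    show "linear_expr (Load r (Const 0))" "growth (Load r (Const 0)) \<le> G"
      using \<open>10 \<le> G\<close> by auto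
    fix \<tau> assume "exec (Seq (Seq (Store r (Const 0) (tick_expr halve r)) c) ?W) \<sigma> \<tau> ((f ^^ n) (f \<sigma>))"
    then obtain \<tau>1 \<sigma>1 \<tau>2 where 3:
      "exec (Seq (Store r (Const 0) (tick_expr halve r)) c) \<sigma> \<tau>1 \<sigma>1"
      "exec ?W \<sigma>1 \<tau>2 ((f ^^ n) (f \<sigma>))" "\<tau> = \<tau>1 + \<tau>2"
      by (rule exec_SeqE)
    have "exec ?W \<sigma> (1 + cost (Load r (Const 0)) \<sigma> + \<tau>1 + \<tau>2) ((f ^^ n) (f \<sigma>))"
      by (rule exec.WhileTrue[OF _ 3(1,2)]) (use pos in simp)
    then show "exec ?W \<sigma> (1 + cost (Load r (Const 0)) \<sigma> + \<tau>) ((f ^^ n) (f \<sigma>))"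
      unfolding 3(3) by (simp only: add.assoc)
  qed (rule Suc(4))
  then show ?case
    unfolding Suc(2)[symmetric] by (simp add: funpow_swap1 algebra_simps)
qed

theorem runs_compile:
  assumes "well_formed G p" "loops_bounded B p \<sigma>" "\<forall>a i. \<sigma> a i < 2 ^ b" "10 \<le> G"
  shows "runs G b (compile p) \<sigma> (poly (steps p) B) (sem p \<sigma>)"
  using assms(1-3)
proof (induction p arbitrary: \<sigma> b)
  case Nop
  then show ?case using runs_Skip[of \<sigma> b G] by simp
next
  case (Asg a i e)
  then show ?case using runs_Store[of \<sigma> b i G e a] by simp
next
  case (Sq p q)
  have 1: "runs G b (compile p) \<sigma> (poly (steps p) B) (sem p \<sigma>)"
    using Sq by simp
  moreover have "runs G (b + G * poly (steps p) B) (compile q) (sem p \<sigma>) (poly (steps q) B) (sem q (sem p \<sigma>))"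
    using Sq 1 by (intro Sq.IH(2)) (auto simp: runs_def)
  ultimately show ?case by (simp add: runs_Seq)
next
  case (Branch e p q)
  note t = runs_test[where G = G and b = b and \<sigma> = \<sigma> and e = e]
  show ?case
  proof (cases "val e \<sigma> = 0")
    case True
    have r: "runs G b (compile q) \<sigma> (poly (steps q) B) (sem q \<sigma>)"
      using Branch True by simp
    have "runs G b (compile (Branch e p q)) \<sigma> (1 + poly (steps q) B) (sem q \<sigma>)"
    proof (rule t[of "compile q", OF _ r])
      show "exec (compile (Branch e p q)) \<sigma> (1 + cost e \<sigma> + \<tau>) (sem q \<sigma>)"
        if "exec (compile q) \<sigma> \<tau> (sem q \<sigma>)" for \<tau>
        unfolding compile.simps using True that by (rule exec.CondFalse)
    qed (use Branch.prems in simp_all)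
    from runs_mono[OF this, of "poly (steps (Branch e p q)) B"] show ?thesis using True by simp
  next
    case False
    have r: "runs G b (compile p) \<sigma> (poly (steps p) B) (sem p \<sigma>)"
      using Branch False by simp
    have "runs G b (compile (Branch e p q)) \<sigma> (1 + poly (steps p) B) (sem p \<sigma>)"
    proof (rule t[of "compile p", OF _ r])
      show "exec (compile (Branch e p q)) \<sigma> (1 + cost e \<sigma> + \<tau>) (sem p \<sigma>)"
        if "exec (compile p) \<sigma> \<tau> (sem p \<sigma>)" for \<tau>
        unfolding compile.simps using False that by (rule exec.CondTrue)
    qed (use Branch.prems in simp_all)
    from runs_mono[OF this, of "poly (steps (Branch e p q)) B"] show ?thesis using False by simp
  qed
next
  case (Loop halve r e p)
  let ?\<sigma> = "put r 0 (val e \<sigma>) \<sigma>"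
  let ?f = "\<lambda>\<sigma>. sem p (tick halve r \<sigma>)"
  let ?n = "loop_count halve (val e \<sigma>)"
  have r: "?\<sigma> r 0 = val e \<sigma>" by (simp add: put_def)
  have 1: "runs G b (Store r (Const 0) e) \<sigma> 1 ?\<sigma>"
    using runs_Store[OF Loop.prems(3), of "Const 0" G e r] Loop.prems(1) \<open>10 \<le> G\<close> by simp
  have "runs G (b + G * 1) (While (Load r (Const 0)) (Seq (Store r (Const 0) (tick_expr halve r)) (compile p)))
      ?\<sigma> (1 + loop_count halve (?\<sigma> r 0) * (poly (steps p) B + 2)) ((?f ^^ loop_count halve (?\<sigma> r 0)) ?\<sigma>)"
  proof (rule runs_While)
    show "runs G b' (compile p) (tick halve r ((?f ^^ i) ?\<sigma>)) (poly (steps p) B) (?f ((?f ^^ i) ?\<sigma>))"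
      if "i < loop_count halve (?\<sigma> r 0)"
        "\<forall>a j. tick halve r ((?f ^^ i) ?\<sigma>) a j < 2 ^ b'" for i b'
      using that Loop.prems(1,2) unfolding r by (intro Loop.IH) simp_all
    show "?f \<sigma> r = tick halve r \<sigma> r" for \<sigma>
      using Loop.prems(1) by (simp add: sem_frame)
    show "\<forall>a i. ?\<sigma> a i < 2 ^ (b + G * 1)"
      using 1 unfolding runs_def by auto
  qed fact
  then have "runs G (b + G * 1) (While (Load r (Const 0)) (Seq (Store r (Const 0) (tick_expr halve r)) (compile p)))
      ?\<sigma> (1 + ?n * (poly (steps p) B + 2)) ((?f ^^ ?n) ?\<sigma>)"
    unfolding r .
  from runs_Seq[OF 1 this]
  have *: "runs G b (compile (Loop halve r e p)) \<sigma> (1 + (1 + ?n * (poly (steps p) B + 2))) (sem (Loop halve r e p) \<sigma>)"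
    unfolding compile.simps sem.simps .
  have "?n * (poly (steps p) B + 2) \<le> B * (poly (steps p) B + 2)"
    using Loop.prems(2) by (intro mult_right_mono) simp_all
  then show ?case
    using runs_mono[OF *, of "poly (steps (Loop halve r e p)) B"] by simp
qed

declare One_nat_def [simp del] \<comment> \<open>keeps the number \<open>1\<close> of the output array a numeral\<close>

section \<open>Loop invariants and Boolean expressions\<close>

lemma put_same [simp]: "put a i k \<sigma> a = (\<sigma> a)(i := k)"
  and put_other [simp]: "a \<noteq> b \<Longrightarrow> put a i k \<sigma> b = \<sigma> b"
  by (simp_all add: put_def)

text \<open>The invariant is indexed by the number of iterations still to come, which is the content
  of the counter. \<open>\<sigma>0\<close> is a second name for the initial store, since
  \<open>\<sigma>\<close> is bound in the third premise.\<close>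

lemma loop_rule:
  assumes "r \<notin> writes p" "I (val e \<sigma>) (put r 0 (val e \<sigma>) \<sigma>)"
    and "\<And>k \<sigma>. k < val e \<sigma>0 \<Longrightarrow> \<sigma> r 0 = Suc k \<Longrightarrow> I (Suc k) \<sigma> \<Longrightarrow> I k (sem p (put r 0 k \<sigma>))"
    and "\<sigma>0 = \<sigma>"
  shows "I 0 (sem (Loop False r e p) \<sigma>)"
proof -
  let ?f = "\<lambda>\<sigma>. sem p (tick False r \<sigma>)"
  have "i \<le> val e \<sigma> \<Longrightarrow>
      (((?f ^^ i) (put r 0 (val e \<sigma>) \<sigma>)) r 0 = val e \<sigma> - i) \<and> I (val e \<sigma> - i) ((?f ^^ i) (put r 0 (val e \<sigma>) \<sigma>))" for i
  proof (induction i)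
    case (Suc i)
    let ?\<sigma> = "(?f ^^ i) (put r 0 (val e \<sigma>) \<sigma>)"
    have *: "?\<sigma> r 0 = Suc (val e \<sigma> - Suc i)" "I (Suc (val e \<sigma> - Suc i)) ?\<sigma>"
      using Suc by (auto simp: Suc_diff_Suc)
    then have "tick False r ?\<sigma> = put r 0 (val e \<sigma> - Suc i) ?\<sigma>"
      by (simp add: tick_def)
    then show ?case
      using assms(3)[OF _ *] Suc.prems assms(1,4) by (simp add: sem_frame)
  qed (use assms(2) in simp)
  from this[of "val e \<sigma>"] show ?thesis by simp
qed

definition NotE :: "expr \<Rightarrow> expr" where
  "NotE e = Minus (Const 1) e"

text \<open>The double negation gives a factor of the form \<open>Minus (Const 1) _\<close>, as
  \<open>linear_expr\<close> requires. The result is the value of \<open>e2\<close>, not just a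
  truth value, so the same construct expresses a conditional summand.\<close>

definition AndE :: "expr \<Rightarrow> expr \<Rightarrow> expr" where
  "AndE e1 e2 = Times (NotE (NotE e1)) e2"

definition LessE :: "expr \<Rightarrow> expr \<Rightarrow> expr" where
  "LessE e1 e2 = Minus e2 e1"

definition EqE :: "expr \<Rightarrow> expr \<Rightarrow> expr" where
  "EqE e1 e2 = NotE (Plus (Minus e1 e2) (Minus e2 e1))"

lemma val_logic [simp]:
  "val (NotE e) \<sigma> = of_bool (val e \<sigma> = 0)"
  "val (AndE e1 e2) \<sigma> = of_bool (val e1 \<sigma> \<noteq> 0) * val e2 \<sigma>"
  "val (LessE e1 e2) \<sigma> = val e2 \<sigma> - val e1 \<sigma>"
  "val (EqE e1 e2) \<sigma> = of_bool (val e1 \<sigma> = val e2 \<sigma>)"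
  by (auto simp: NotE_def AndE_def LessE_def EqE_def)

lemma linear_logic [simp]:
  "linear_expr (NotE e) = linear_expr e"
  "linear_expr (AndE e1 e2) = (linear_expr e1 \<and> linear_expr e2)"
  "linear_expr (LessE e1 e2) = (linear_expr e1 \<and> linear_expr e2)"
  "linear_expr (EqE e1 e2) = (linear_expr e1 \<and> linear_expr e2)"
  by (auto simp: NotE_def AndE_def LessE_def EqE_def)

lemma growth_logic [simp]:
  "growth (NotE e) = growth e + 3"
  "growth (AndE e1 e2) = growth e1 + growth e2 + 7"
  "growth (LessE e1 e2) = growth e1 + growth e2 + 1"
  "growth (EqE e1 e2) = 2 * growth e1 + 2 * growth e2 + 6"
  by (auto simp: NotE_def AndE_def LessE_def EqE_def)

section \<open>Push-relabel steps in networks with unit costs\<close>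

text \<open>The pigeonhole principle. It yields both the gap between heights and the residue that no
  height has.\<close>

lemma missing_value:
  fixes g :: "nat \<Rightarrow> nat"
  assumes "finite A" "card A < k"
  obtains r where "r < k" "\<And>v. v \<in> A \<Longrightarrow> g v \<noteq> r"
proof -
  have "card (g ` A) < card {..<k}"
    using card_image_le[OF assms(1), of g] assms(2) by simp
  then have "\<not> {..<k} \<subseteq> g ` A"
    using assms(1) by (meson card_mono finite_imageI not_less)
  then show ?thesis using that by blast
qed

section \<open>Circulations, reduced costs and approximate optimality\<close>

locale network =
  fixes n m :: nat and tl hd :: "nat \<Rightarrow> nat"
  assumes tl_less: "a < m \<Longrightarrow> tl a < n" and hd_less: "a < m \<Longrightarrow> hd a < n"
    and n_pos: "0 < n"
begin

text \<open>Written as one sum over arcs, in which loops cancel; identifying the sink with the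
  source may create loops.\<close>

definition excess :: "(nat \<Rightarrow> int) \<Rightarrow> nat \<Rightarrow> int" where
  "excess x v = (\<Sum>a<m. (of_bool (hd a = v) - of_bool (tl a = v)) * x a)"

text \<open>The sign is the change of \<open>\<bar>x a - y a\<bar>\<close> caused by one more unit,
  in \<open>red_back\<close> by one unit less. At \<open>x a = y a\<close> both are
  \<open>1\<close>, which is where convexity enters.\<close>

definition red_forw :: "(nat \<Rightarrow> int) \<Rightarrow> (nat \<Rightarrow> int) \<Rightarrow> (nat \<Rightarrow> int) \<Rightarrow> nat \<Rightarrow> int" where
  "red_forw y x h a = (int n + 1) * (if x a < y a then -1 else 1) + h (hd a) - h (tl a)"

definition red_back :: "(nat \<Rightarrow> int) \<Rightarrow> (nat \<Rightarrow> int) \<Rightarrow> (nat \<Rightarrow> int) \<Rightarrow> nat \<Rightarrow> int" where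
  "red_back y x h a = (int n + 1) * (if x a \<le> y a then 1 else -1) + h (tl a) - h (hd a)"

definition eps_opt :: "(nat \<Rightarrow> int) \<Rightarrow> (nat \<Rightarrow> int) \<Rightarrow> (nat \<Rightarrow> int) \<Rightarrow> (nat \<Rightarrow> int) \<Rightarrow> bool" where
  "eps_opt u y x h \<longleftrightarrow> (\<forall>a<m. 0 \<le> x a \<and> x a \<le> u a \<and>
     (x a < u a \<longrightarrow> -1 \<le> red_forw y x h a) \<and> (0 < x a \<longrightarrow> -1 \<le> red_back y x h a))"

text \<open>Summation by parts. A constant \<open>p\<close> shows that the total excess vanishes, an
  indicator gives the balance of a cut, and integral potentials give the duality argument for
  optimality.\<close>

lemma sum_excess:
  "(\<Sum>v<n. p v * excess x v) = (\<Sum>a<m. (p (hd a) - p (tl a)) * x a)"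
proof -
  have "(\<Sum>v<n. p v * excess x v) =
      (\<Sum>a<m. \<Sum>v<n. p v * ((of_bool (hd a = v) - of_bool (tl a = v)) * x a))"
    unfolding excess_def sum_distrib_left by (rule sum.swap)
  also have "\<dots> = (\<Sum>a<m. (p (hd a) - p (tl a)) * x a)"
  proof (rule sum.cong)
    fix a assume "a \<in> {..<m}"
    then have "tl a < n" "hd a < n" using tl_less hd_less by auto
    then have "(\<Sum>v<n. p v * of_bool (hd a = v)) = p (hd a)" "(\<Sum>v<n. p v * of_bool (tl a = v)) = p (tl a)"
      by (simp_all add: of_bool_def if_distrib cong: if_cong)
    note * = this
    have "(\<Sum>v<n. p v * ((of_bool (hd a = v) - of_bool (tl a = v)) * x a)) =
        (\<Sum>v<n. x a * (p v * of_bool (hd a = v)) - x a * (p v * of_bool (tl a = v)))"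
      by (intro sum.cong) (auto simp: algebra_simps)
    also have "\<dots> = x a * p (hd a) - x a * p (tl a)"
      by (simp only: sum_subtractf sum_distrib_left[symmetric] *)
    also have "\<dots> = (p (hd a) - p (tl a)) * x a"
      by (simp add: algebra_simps)
    finally show "(\<Sum>v<n. p v * ((of_bool (hd a = v) - of_bool (tl a = v)) * x a)) = (p (hd a) - p (tl a)) * x a" .
  qed simp
  finally show ?thesis .
qed

lemma excess_upd:
  assumes "a < m"
  shows "excess (x(a := x a + d)) v = excess x v + (of_bool (hd a = v) - of_bool (tl a = v)) * d"
proof -
  have "excess (x(a := x a + d)) v =
      (\<Sum>b<m. (of_bool (hd b = v) - of_bool (tl b = v)) * x b +
        (if b = a then (of_bool (hd a = v) - of_bool (tl a = v)) * d else 0))"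
    unfolding excess_def by (intro sum.cong) (auto simp: algebra_simps)
  also have "\<dots> = excess x v + (of_bool (hd a = v) - of_bool (tl a = v)) * d"
    using assms by (simp add: sum.distrib excess_def)
  finally show ?thesis .
qed

lemma excess_cong: "(\<And>a. a < m \<Longrightarrow> x a = x' a) \<Longrightarrow> excess x v = excess x' v"
  unfolding excess_def by (intro sum.cong) auto

lemma red_cong:
  "x a = x' a \<Longrightarrow> red_forw y x h a = red_forw y x' h a"
  "x a = x' a \<Longrightarrow> red_back y x h a = red_back y x' h a"
  by (simp_all add: red_forw_def red_back_def)

text \<open>Taking the unit back costs \<open>- red_forw y x h a\<close>, which is positive, and by
  convexity the next unit forward is not cheaper. Other arcs are unaffected.\<close>

lemma eps_opt_push_forw:
  assumes "eps_opt u y x h" "a < m" "x a < u a" "red_forw y x h a < 0"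
  shows "eps_opt u y (x(a := x a + 1)) h"
  unfolding eps_opt_def
proof (intro allI impI)
  fix b assume b: "b < m"
  let ?x = "x(a := x a + 1)"
  show "0 \<le> ?x b \<and> ?x b \<le> u b \<and>
     (?x b < u b \<longrightarrow> -1 \<le> red_forw y ?x h b) \<and> (0 < ?x b \<longrightarrow> -1 \<le> red_back y ?x h b)"
  proof (cases "b = a")
    case True
    have "red_forw y x h a \<le> red_forw y ?x h a" "red_back y ?x h a = - red_forw y x h a"
      by (auto simp: red_forw_def red_back_def)
    then show ?thesis using assms b True by (auto simp: eps_opt_def)
  next
    case False
    then show ?thesis using assms(1) b red_cong[of ?x b x] by (simp add: eps_opt_def)
  qed
qed

lemma eps_opt_push_back:
  assumes "eps_opt u y x h" "a < m" "0 < x a" "red_back y x h a < 0"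
  shows "eps_opt u y (x(a := x a - 1)) h"
  unfolding eps_opt_def
proof (intro allI impI)
  fix b assume b: "b < m"
  let ?x = "x(a := x a - 1)"
  show "0 \<le> ?x b \<and> ?x b \<le> u b \<and>
     (?x b < u b \<longrightarrow> -1 \<le> red_forw y ?x h b) \<and> (0 < ?x b \<longrightarrow> -1 \<le> red_back y ?x h b)"
  proof (cases "b = a")
    case True
    have "red_back y x h a \<le> red_back y ?x h a" "red_forw y ?x h a = - red_back y x h a"
      by (auto simp: red_forw_def red_back_def)
    then show ?thesis using assms b True by (auto simp: eps_opt_def)
  next
    case False
    then show ?thesis using assms(1) b red_cong[of ?x b x] by (simp add: eps_opt_def)
  qed
qed

text \<open>Raising \<open>v\<close> lowers, by one, only the reduced costs of residual arcs from
  \<open>v\<close> to other nodes. These were nonnegative, so they stay within the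
  tolerance.\<close>

lemma eps_opt_relabel:
  assumes "eps_opt u y x h"
    and "\<And>a. a < m \<Longrightarrow> tl a = v \<Longrightarrow> x a < u a \<Longrightarrow> 0 \<le> red_forw y x h a"
    and "\<And>a. a < m \<Longrightarrow> hd a = v \<Longrightarrow> 0 < x a \<Longrightarrow> 0 \<le> red_back y x h a"
  shows "eps_opt u y x (h(v := h v + 1))"
  unfolding eps_opt_def
proof (intro allI impI)
  fix a assume a: "a < m"
  have "red_forw y x (h(v := h v + 1)) a = red_forw y x h a + of_bool (hd a = v) - of_bool (tl a = v)"
    "red_back y x (h(v := h v + 1)) a = red_back y x h a + of_bool (tl a = v) - of_bool (hd a = v)"
    by (auto simp: red_forw_def red_back_def)
  then show "0 \<le> x a \<and> x a \<le> u a \<and> (x a < u a \<longrightarrow> -1 \<le> red_forw y x (h(v := h v + 1)) a) \<and>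
     (0 < x a \<longrightarrow> -1 \<le> red_back y x (h(v := h v + 1)) a)"
    using assms(1) assms(2,3)[OF a] a unfolding eps_opt_def by (cases "hd a = v"; cases "tl a = v") auto
qed

section \<open>Passing to the next bit\<close>

definition refined :: "(nat \<Rightarrow> int) \<Rightarrow> (nat \<Rightarrow> int) \<Rightarrow> (nat \<Rightarrow> int) \<Rightarrow> (nat \<Rightarrow> int) \<Rightarrow> nat \<Rightarrow> int" where
  "refined u y x h a =
     (if 2 * x a < u a \<and> red_forw y (\<lambda>a. 2 * x a) h a < -1 then 2 * x a + 1 else 2 * x a)"

text \<open>The backward conditions survive doubling, since \<open>2 * z \<le> Y\<close> iff
  \<open>z \<le> Y div 2\<close>. A forward condition can break only if \<open>u a\<close> is odd,
  which opens a residual unit, or \<open>y a\<close> is odd, which makes one unit cheap; sending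
  this unit repairs it.\<close>

lemma eps_opt_refined:
  assumes "eps_opt (\<lambda>a. u a div 2) (\<lambda>a. y a div 2) x h"
  shows "eps_opt u y (refined u y x h) h"
  unfolding eps_opt_def
proof (intro allI impI)
  fix a assume a: "a < m"
  define z where "z = x a"
  define U where "U = u a"
  define Y where "Y = y a"
  define r where "r = h (hd a) - h (tl a)"
  define N where "N = int n + 1"
  have *: "0 \<le> z" "z \<le> U div 2" "z < U div 2 \<Longrightarrow> -1 \<le> N * (if z < Y div 2 then -1 else 1) + r"
    "0 < z \<Longrightarrow> -1 \<le> N * (if z \<le> Y div 2 then 1 else -1) - r"
    using assms a by (auto simp: eps_opt_def z_def U_def Y_def r_def N_def red_forw_def red_back_def)
  have N: "0 < N" by (simp add: N_def)
  define z' where "z' = (if 2 * z < U \<and> N * (if 2 * z < Y then -1 else 1) + r < -1 then 2 * z + 1 else 2 * z)"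
  have "0 \<le> z' \<and> z' \<le> U \<and> (z' < U \<longrightarrow> -1 \<le> N * (if z' < Y then -1 else 1) + r) \<and>
    (0 < z' \<longrightarrow> -1 \<le> N * (if z' \<le> Y then 1 else -1) - r)"
  proof (cases "2 * z < U \<and> N * (if 2 * z < Y then -1 else 1) + r < -1")
    case True
    then have z': "z' = 2 * z + 1" by (simp add: z'_def)
    have 1: "-1 \<le> N * (if z' < Y then -1 else 1) + r" if "z' < U"
    proof -
      have "z < U div 2" using that z' by linarith
      moreover have "z' < Y \<Longrightarrow> z < Y div 2" using z' by linarith
      moreover have "z < Y div 2 \<Longrightarrow> 2 * z < Y" by linarith
      ultimately show ?thesis using *(3) True N by (auto split: if_splits)
    qed
    have 2: "-1 \<le> N * (if z' \<le> Y then 1 else -1) - r"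
      using True N unfolding z' by (auto split: if_splits)
    show ?thesis using 1 2 True *(1,2) z' by auto
  next
    case False
    then have z': "z' = 2 * z" by (simp add: z'_def)
    have "2 * z \<le> Y \<longleftrightarrow> z \<le> Y div 2" by linarith
    then show ?thesis using False * unfolding z' by auto
  qed
  moreover have "refined u y x h a = z'"
    by (simp add: refined_def z'_def z_def U_def Y_def r_def N_def red_forw_def add_diff_eq)
  ultimately show "0 \<le> refined u y x h a \<and> refined u y x h a \<le> u a \<and>
     (refined u y x h a < u a \<longrightarrow> -1 \<le> red_forw y (refined u y x h) h a) \<and>
     (0 < refined u y x h a \<longrightarrow> -1 \<le> red_back y (refined u y x h) h a)"
    by (simp add: red_forw_def red_back_def U_def Y_def r_def N_def algebra_simps)
qed

definition positive_excess :: "(nat \<Rightarrow> int) \<Rightarrow> int" where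
  "positive_excess x = (\<Sum>v<n. max 0 (excess x v))"

text \<open>Doubling keeps a balanced flow balanced, and each additional unit arrives at a single
  head.\<close>

lemma positive_excess_refined:
  assumes "\<And>v. v < n \<Longrightarrow> excess x v = 0"
  shows "positive_excess (refined u y x h) \<le> int m"
proof -
  define \<delta> where "\<delta> a = refined u y x h a - 2 * x a" for a
  have \<delta>: "0 \<le> \<delta> a" "\<delta> a \<le> 1" for a
    by (simp_all add: \<delta>_def refined_def)
  have "max 0 (excess (refined u y x h) v) \<le> (\<Sum>a<m. of_bool (hd a = v))" if "v < n" for v
  proof -
    have "excess (refined u y x h) v = 2 * excess x v + (\<Sum>a<m. (of_bool (hd a = v) - of_bool (tl a = v)) * \<delta> a)"
      unfolding excess_def sum_distrib_left sum.distrib[symmetric]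
      by (intro sum.cong) (auto simp: \<delta>_def algebra_simps)
    also have "\<dots> = (\<Sum>a<m. (of_bool (hd a = v) - of_bool (tl a = v)) * \<delta> a)"
      using assms[OF that] by simp
    also have "\<dots> \<le> (\<Sum>a<m. of_bool (hd a = v))"
    proof (intro sum_mono)
      show "(of_bool (hd a = v) - of_bool (tl a = v)) * \<delta> a \<le> of_bool (hd a = v)" for a
        using \<delta>[of a] by (auto simp: of_bool_def)
    qed
    finally show ?thesis by (simp add: sum_nonneg)
  qed
  then have "positive_excess (refined u y x h) \<le> (\<Sum>v<n. \<Sum>a<m. of_bool (hd a = v))"
    unfolding positive_excess_def by (intro sum_mono) auto
  also have "\<dots> = (\<Sum>a<m. \<Sum>v<n. of_bool (hd a = v))"
    by (rule sum.swap)
  also have "\<dots> \<le> (\<Sum>a<m. 1)"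
    using hd_less by (intro sum_mono) (simp add: of_bool_def)
  finally show ?thesis by simp
qed

section \<open>Bounding the heights\<close>

text \<open>
  If \<open>v\<close> were higher, then some interval of \<open>n + 2\<close> consecutive heights above \<open>R\<close> would contain no
  node. No residual arc leaves the set of nodes above such a gap, so that this set
  cannot receive more than it sends, although its nodes have no deficit and \<open>v\<close> has an excess.
\<close>

lemma height_bound:
  assumes opt: "eps_opt u y x h" and deficit: "\<And>w. w < n \<Longrightarrow> excess x w < 0 \<Longrightarrow> h w \<le> R"
    and v: "v < n" "0 < excess x v"
  shows "h v \<le> R + int n * (int n + 2)"
proof (rule ccontr)
  assume high: "\<not> ?thesis"
  \<comment> \<open>The width is the largest scaled cost \<open>n + 1\<close> plus the tolerance
    \<open>1\<close>: a residual arc that drops by more than this has reduced cost below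
    \<open>-1\<close>.\<close>
  define K where "K = int n + 2"
  \<comment> \<open>The \<open>n\<close> intervals above \<open>R\<close> face only the
    \<open>n - 1\<close> nodes other than \<open>v\<close>, which lies above all of them. This is
    the origin of the bound \<open>n * (n + 2)\<close>.\<close>
  have "card ({..<n} - {v}) < n" using v(1) by simp
  then obtain j where j: "j < n" "\<And>w. w \<in> {..<n} - {v} \<Longrightarrow> nat ((h w - R - 1) div K) \<noteq> j"
    using missing_value[of "{..<n} - {v}" n "\<lambda>w. nat ((h w - R - 1) div K)"] by auto
  define lo where "lo = R + int j * K"
  have K: "0 < K" by (simp add: K_def)
  have gap: "h w \<le> lo \<or> lo + K < h w" if w: "w < n" for w
  proof (cases "w = v")
    case True
    have "int j * K + K = (int j + 1) * K" by (simp add: algebra_simps)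
    also have "\<dots> \<le> int n * K" using j(1) K by (intro mult_right_mono) auto
    finally show ?thesis using high True by (simp add: lo_def K_def)
  next
    case False
    then have ne: "nat ((h w - R - 1) div K) \<noteq> j" using j(2) w by simp
    show ?thesis
    proof (rule ccontr)
      assume "\<not> ?thesis"
      then have "int j * K \<le> h w - R - 1" "h w - R - 1 < int j * K + K"
        by (auto simp: lo_def)
      then have "(h w - R - 1) div K = int j"
        using K by (intro int_div_pos_eq[of _ _ _ "h w - R - 1 - int j * K"]) (auto simp: algebra_simps)
      then show False using ne by simp
    qed
  qed
  have v_high: "lo + K < h v"
  proof -
    have "int j * K \<le> int n * K" using j(1) K by (intro mult_right_mono) auto
    then have "lo < h v" using high unfolding lo_def K_def by linarith
    then show ?thesis using gap[OF v(1)] by auto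
  qed
  let ?p = "\<lambda>w. of_bool (lo < h w) :: int"
  have "0 < ?p v * excess x v" using v K v_high by auto
  moreover have "0 \<le> ?p w * excess x w" if "w < n" for w
  proof -
    have "R \<le> lo" using K by (simp add: lo_def)
    then show ?thesis using deficit[OF that] by force
  qed
  ultimately have "0 < (\<Sum>w<n. ?p w * excess x w)"
    using v(1) by (intro sum_pos2[of _ v]) auto
  \<comment> \<open>Only arcs entering the high set could contribute positively. They carry no flow,
    because the reverse residual arc would jump down over the gap.\<close>
  moreover have "(\<Sum>a<m. (?p (hd a) - ?p (tl a)) * x a) \<le> 0"
  proof (rule sum_nonpos)
    fix a assume "a \<in> {..<m}"
    then have a: "a < m" by simp
    have *: "0 \<le> x a" "0 < x a \<longrightarrow> -1 \<le> red_back y x h a"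
      using opt a by (auto simp: eps_opt_def)
    show "(?p (hd a) - ?p (tl a)) * x a \<le> 0"
    proof (cases "lo < h (hd a) \<and> \<not> lo < h (tl a)")
      case True
      then have "lo + K < h (hd a)" using gap[OF hd_less[OF a]] by auto
      then have "red_back y x h a < -1"
        using True by (auto simp: red_back_def K_def)
      then have "x a = 0" using * by auto
      then show ?thesis by simp
    next
      case False
      then show ?thesis using *(1) by (auto simp: of_bool_def)
    qed
  qed
  ultimately show False unfolding sum_excess by simp
qed

section \<open>Ranks modulo \<open>n + 1\<close> and the termination measure\<close>

text \<open>
  Pushes along arcs of negative cost may go to higher nodes. But every push lowers the height modulo
  \<open>n + 1\<close> by one, and \<open>n\<close> nodes leave some residue unused, so that the distance to this residue decreases.
\<close>

definition hole :: "(nat \<Rightarrow> int) \<Rightarrow> int" where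
  "hole h = (SOME r. \<forall>v<n. h v mod (int n + 1) \<noteq> r mod (int n + 1))"

definition rank :: "(nat \<Rightarrow> int) \<Rightarrow> nat \<Rightarrow> int" where
  "rank h v = (h v - hole h) mod (int n + 1)"

lemma hole: "v < n \<Longrightarrow> h v mod (int n + 1) \<noteq> hole h mod (int n + 1)"
proof -
  obtain r where r: "r < n + 1" "\<And>v. v < n \<Longrightarrow> nat (h v mod (int n + 1)) \<noteq> r"
    using missing_value[of "{..<n}" "n + 1" "\<lambda>v. nat (h v mod (int n + 1))"] by auto
  have "\<forall>v<n. h v mod (int n + 1) \<noteq> int r mod (int n + 1)"
    using r by fastforce
  then have "\<forall>v<n. h v mod (int n + 1) \<noteq> hole h mod (int n + 1)"
    unfolding hole_def by (rule someI)
  then show "v < n \<Longrightarrow> ?thesis" by simp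
qed

lemma rank_bounds: "v < n \<Longrightarrow> 0 < rank h v" "rank h v \<le> int n"
proof -
  have "0 \<le> rank h v" "rank h v < int n + 1"
    unfolding rank_def by (intro pos_mod_sign pos_mod_bound; simp)+
  then show "rank h v \<le> int n" by simp
  assume "v < n"
  from hole[OF this, of h] have "rank h v \<noteq> 0"
    unfolding rank_def by (simp add: mod_eq_dvd_iff dvd_eq_mod_eq_0)
  with \<open>0 \<le> rank h v\<close> show "0 < rank h v" by simp
qed

text \<open>The multiple of \<open>n + 1\<close> is the arc cost, which disappears in the residue.
  As no node has rank \<open>0\<close>, the step down by one does not wrap around.\<close>

lemma rank_push:
  assumes "h v = h w + (int n + 1) * c + 1" "v < n" "w < n"
  shows "rank h v = rank h w + 1" "v \<noteq> w"
proof -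
  have "rank h w = (rank h v - 1) mod (int n + 1)"
  proof -
    have "h w - hole h = (h v - hole h - 1) + (int n + 1) * (- c)" using assms(1) by simp
    then have "rank h w = (h v - hole h - 1) mod (int n + 1)" unfolding rank_def by (metis mod_mult_self2)
    then show ?thesis unfolding rank_def by (simp add: mod_diff_left_eq)
  qed
  also have "\<dots> = rank h v - 1"
    using rank_bounds(1)[OF assms(2), of h] rank_bounds(2)[of h v] by (intro mod_pos_pos_trivial) auto
  finally show "rank h v = rank h w + 1" by simp
  then show "v \<noteq> w" by auto
qed

text \<open>\<open>R\<close> bounds the heights at the start of a phase. Pushes and relabels start
  at nodes with positive excess, so no new deficits arise and deficient nodes keep their heights;
  they provide the reference level for \<open>height_bound\<close>.\<close>

definition invariant ::
  "(nat \<Rightarrow> int) \<Rightarrow> (nat \<Rightarrow> int) \<Rightarrow> int \<Rightarrow> (nat \<Rightarrow> int) \<Rightarrow> (nat \<Rightarrow> int) \<Rightarrow> bool" where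
  "invariant u y R x h \<longleftrightarrow> eps_opt u y x h \<and> positive_excess x \<le> int m \<and>
     (\<forall>v<n. h v \<le> R + int n * (int n + 2)) \<and> (\<forall>v<n. excess x v < 0 \<longrightarrow> h v \<le> R)"

text \<open>A lexicographic measure. A relabel lowers the first sum by one but may move
  \<open>hole\<close> and so change every rank; the second sum stays between \<open>0\<close> and
  \<open>m * n\<close>, which the factor outweighs. A push keeps heights and \<open>hole\<close> and
  lowers the second sum.\<close>

definition weight :: "int \<Rightarrow> (nat \<Rightarrow> int) \<Rightarrow> (nat \<Rightarrow> int) \<Rightarrow> int" where
  "weight R x h = (int m * int n + 1) * (\<Sum>v<n. R + int n * (int n + 2) - h v) +
     (\<Sum>v<n. max 0 (excess x v) * rank h v)"

text \<open>The positive part at \<open>v\<close> drops by exactly one, while at \<open>w\<close> it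
  grows by at most one, and not at all if \<open>w\<close> has a deficit. It is used with
  \<open>f\<close> constant and with \<open>f\<close> the rank.\<close>

lemma push_sums:
  assumes ex: "\<And>i. i < n \<Longrightarrow> excess x' i = excess x i - of_bool (i = v) + of_bool (i = w)"
    and v: "v < n" "0 < excess x v" and w: "w < n" "v \<noteq> w"
    and f: "\<And>i. i < n \<Longrightarrow> 0 \<le> f i"
  shows "(\<Sum>i<n. max 0 (excess x' i) * f i) \<le> (\<Sum>i<n. max 0 (excess x i) * f i) - f v + f w"
proof -
  have "(\<Sum>i<n. max 0 (excess x' i) * f i) \<le>
      (\<Sum>i<n. (max 0 (excess x i) - of_bool (i = v) + of_bool (i = w)) * f i)"
  proof (intro sum_mono mult_right_mono)
    fix i assume "i \<in> {..<n}"
    then show "max 0 (excess x' i) \<le> max 0 (excess x i) - of_bool (i = v) + of_bool (i = w)" "0 \<le> f i"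
      using ex[of i] v w f by auto
  qed
  also have "\<dots> = (\<Sum>i<n. max 0 (excess x i) * f i) - (\<Sum>i<n. of_bool (i = v) * f i) + (\<Sum>i<n. of_bool (i = w) * f i)"
    by (simp add: sum.distrib sum_subtractf algebra_simps)
  also have "\<dots> = (\<Sum>i<n. max 0 (excess x i) * f i) - f v + f w"
    using v(1) w(1) by (simp add: of_bool_def if_distrib if_distribR cong: if_cong)
  finally show ?thesis .
qed

lemma push_invariant:
  assumes inv: "invariant u y R x h" and opt: "eps_opt u y x' h"
    and ex: "\<And>i. i < n \<Longrightarrow> excess x' i = excess x i - of_bool (i = v) + of_bool (i = w)"
    and v: "v < n" "0 < excess x v" and w: "w < n" and h: "h v = h w + (int n + 1) * c + 1"
  shows "invariant u y R x' h" "weight R x' h < weight R x h"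
proof -
  note r = rank_push[OF h v(1) w]
  have "positive_excess x' \<le> positive_excess x"
    using push_sums[OF ex v w r(2), of "\<lambda>_. 1"] by (simp add: positive_excess_def)
  moreover have "h i \<le> R" if "i < n" "excess x' i < 0" for i
  proof (cases "excess x i < 0")
    case True
    then show ?thesis using inv that by (simp add: invariant_def)
  next
    case False
    then show ?thesis using ex[OF that(1)] that(2) v(2) by (cases "i = v"; cases "i = w") auto
  qed
  ultimately show "invariant u y R x' h"
    using inv opt by (auto simp: invariant_def)
  have "(\<Sum>i<n. max 0 (excess x' i) * rank h i) \<le> (\<Sum>i<n. max 0 (excess x i) * rank h i) - rank h v + rank h w"
    using rank_bounds(1) by (intro push_sums[OF ex v w r(2)]) (auto intro: less_imp_le)
  then show "weight R x' h < weight R x h"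
    using r(1) by (simp add: weight_def)
qed

lemma push_forw_invariant:
  assumes "invariant u y R x h" "a < m" "x a < u a" "red_forw y x h a < 0" "0 < excess x (tl a)"
  shows "invariant u y R (x(a := x a + 1)) h" "weight R (x(a := x a + 1)) h < weight R x h"
proof -
  have "red_forw y x h a = -1"
    using assms(1-4) by (force simp: invariant_def eps_opt_def)
  then have h: "h (tl a) = h (hd a) + (int n + 1) * (if x a < y a then -1 else 1) + 1"
    unfolding red_forw_def by linarith
  have opt: "eps_opt u y (x(a := x a + 1)) h"
    using assms by (intro eps_opt_push_forw) (auto simp: invariant_def)
  have ex: "excess (x(a := x a + 1)) i = excess x i - of_bool (i = tl a) + of_bool (i = hd a)" for i
    using excess_upd[OF assms(2), of x 1 i] by (auto simp: of_bool_def)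
  show "invariant u y R (x(a := x a + 1)) h" "weight R (x(a := x a + 1)) h < weight R x h"
    using push_invariant[OF assms(1) opt ex tl_less assms(5) hd_less h] assms(2) by auto
qed

lemma push_back_invariant:
  assumes "invariant u y R x h" "a < m" "0 < x a" "red_back y x h a < 0" "0 < excess x (hd a)"
  shows "invariant u y R (x(a := x a - 1)) h" "weight R (x(a := x a - 1)) h < weight R x h"
proof -
  have "red_back y x h a = -1"
    using assms(1-4) by (force simp: invariant_def eps_opt_def)
  then have h: "h (hd a) = h (tl a) + (int n + 1) * (if x a \<le> y a then 1 else -1) + 1"
    unfolding red_back_def by linarith
  have opt: "eps_opt u y (x(a := x a - 1)) h"
    using assms by (intro eps_opt_push_back) (auto simp: invariant_def)
  have ex: "excess (x(a := x a - 1)) i = excess x i - of_bool (i = hd a) + of_bool (i = tl a)" for i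
    using excess_upd[OF assms(2), of x "-1" i] by (auto simp: of_bool_def)
  show "invariant u y R (x(a := x a - 1)) h" "weight R (x(a := x a - 1)) h < weight R x h"
    using push_invariant[OF assms(1) opt ex hd_less assms(5) tl_less h] assms(2) by auto
qed

lemma rank_sum_bounds:
  assumes "positive_excess x \<le> int m"
  shows "0 \<le> (\<Sum>v<n. max 0 (excess x v) * rank h v)" "(\<Sum>v<n. max 0 (excess x v) * rank h v) \<le> int m * int n"
proof -
  show "0 \<le> (\<Sum>v<n. max 0 (excess x v) * rank h v)"
    using rank_bounds(1) by (intro sum_nonneg mult_nonneg_nonneg) (auto intro: less_imp_le)
  have "(\<Sum>v<n. max 0 (excess x v) * rank h v) \<le> (\<Sum>v<n. max 0 (excess x v) * int n)"
    using rank_bounds(2) by (intro sum_mono mult_left_mono) auto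
  also have "\<dots> = positive_excess x * int n"
    by (simp add: positive_excess_def sum_distrib_right)
  also have "\<dots> \<le> int m * int n"
    using assms by (intro mult_right_mono) auto
  finally show "(\<Sum>v<n. max 0 (excess x v) * rank h v) \<le> int m * int n" .
qed

lemma relabel_invariant:
  assumes inv: "invariant u y R x h" and v: "v < n" "0 < excess x v"
    and "\<And>a. a < m \<Longrightarrow> tl a = v \<Longrightarrow> x a < u a \<Longrightarrow> 0 \<le> red_forw y x h a"
    and "\<And>a. a < m \<Longrightarrow> hd a = v \<Longrightarrow> 0 < x a \<Longrightarrow> 0 \<le> red_back y x h a"
  shows "invariant u y R x (h(v := h v + 1))" "weight R x (h(v := h v + 1)) < weight R x h"
proof -
  let ?h = "h(v := h v + 1)"
  have opt: "eps_opt u y x ?h"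
    using assms by (intro eps_opt_relabel) (auto simp: invariant_def)
  have deficit: "?h w \<le> R" if "w < n" "excess x w < 0" for w
    using inv that v by (auto simp: invariant_def)
  \<comment> \<open>The bound is applied to the heights after the relabel, so it needs no room for
    one more unit.\<close>
  have "?h v \<le> R + int n * (int n + 2)"
    by (rule height_bound[OF opt deficit v])
  then show "invariant u y R x ?h"
    using inv opt deficit by (auto simp: invariant_def)
  have "(\<Sum>i<n. R + int n * (int n + 2) - ?h i) = (\<Sum>i<n. R + int n * (int n + 2) - h i - of_bool (i = v))"
    by (intro sum.cong) auto
  also have "\<dots> = (\<Sum>i<n. R + int n * (int n + 2) - h i) - 1"
    using v(1) by (simp add: sum_subtractf of_bool_def)
  finally have *: "(\<Sum>i<n. R + int n * (int n + 2) - ?h i) = (\<Sum>i<n. R + int n * (int n + 2) - h i) - 1" .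
  have "positive_excess x \<le> int m" using inv by (simp add: invariant_def)
  from rank_sum_bounds[OF this, of h] rank_sum_bounds[OF this, of ?h]
  show "weight R x ?h < weight R x h"
    unfolding weight_def * by (simp add: algebra_simps)
qed

lemma weight_pos:
  assumes "invariant u y R x h" "v < n" "0 < excess x v"
  shows "0 < weight R x h"
proof -
  have "0 < (\<Sum>v<n. max 0 (excess x v) * rank h v)"
  proof (rule sum_pos2[of _ v])
    show "0 < max 0 (excess x v) * rank h v"
      using assms rank_bounds(1)[of v h] by simp
    show "0 \<le> max 0 (excess x i) * rank h i" if "i \<in> {..<n}" for i
      using that rank_bounds(1)[of i h] by (intro mult_nonneg_nonneg) auto
  qed (use assms in auto)
  moreover have "0 \<le> (int m * int n + 1) * (\<Sum>v<n. R + int n * (int n + 2) - h v)"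
    using assms by (intro mult_nonneg_nonneg sum_nonneg) (auto simp: invariant_def)
  ultimately show ?thesis by (simp add: weight_def)
qed

lemma weight_le:
  assumes "invariant u y R x h" "\<And>v. v < n \<Longrightarrow> 0 \<le> h v"
  shows "weight R x h \<le> (int m * int n + 1) * (int n * (R + int n * (int n + 2))) + int m * int n"
proof -
  have "(\<Sum>v<n. R + int n * (int n + 2) - h v) \<le> (\<Sum>v<n. R + int n * (int n + 2))"
    using assms(2) by (intro sum_mono) auto
  also have "\<dots> = int n * (R + int n * (int n + 2))" by simp
  finally have "(\<Sum>v<n. R + int n * (int n + 2) - h v) \<le> int n * (R + int n * (int n + 2))" .
  then show ?thesis
    unfolding weight_def using assms(1)
    by (intro add_mono mult_left_mono rank_sum_bounds) (auto simp: invariant_def)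
qed

lemma balanced_if_no_excess:
  assumes "\<And>v. v < n \<Longrightarrow> excess x v \<le> 0" "v < n"
  shows "excess x v = 0"
proof -
  have "(\<Sum>v<n. excess x v) = 0" using sum_excess[of "\<lambda>_. 1" x] by simp
  then have "(\<Sum>v<n. - excess x v) = 0" by (simp add: sum_negf)
  then show ?thesis
    using assms by (subst (asm) sum_nonneg_eq_0_iff) auto
qed

section \<open>Optimality from integral dual potentials\<close>

text \<open>
  Rounding the heights down to multiples of \<open>n + 1\<close>, after moving an unused residue to the top,
  turns reduced costs at least \<open>-1\<close> into nonnegative ones.
\<close>

theorem eps_opt_imp_optimal:
  assumes opt: "eps_opt u y x h" and x: "\<And>v. v < n \<Longrightarrow> excess x v = 0"
    and z: "\<And>a. a < m \<Longrightarrow> 0 \<le> z a \<and> z a \<le> u a" "\<And>v. v < n \<Longrightarrow> excess z v = 0"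
  shows "(\<Sum>a<m. \<bar>x a - y a\<bar>) \<le> (\<Sum>a<m. \<bar>z a - y a\<bar>)"
proof -
  define N where "N = int n + 1"
  define p where "p v = (h v - hole h - 1) div N" for v
  have N: "0 < N" by (simp add: N_def)
  \<comment> \<open>The remainder of \<open>w\<close> is at most \<open>N - 2\<close>, so the
    tolerance \<open>+ 1\<close> causes no carry into the quotient.\<close>
  have round: "p v \<le> p w + c" if "h v \<le> h w + N * c + 1" "w < n" for v w c
  proof -
    have "(h w - hole h - 1) mod N \<noteq> N - 1"
    proof
      assume "(h w - hole h - 1) mod N = N - 1"
      then have "(h w - hole h - 1 + 1) mod N = 0"
        using mod_add_left_eq[of "h w - hole h - 1" N 1] by simp
      then have "rank h w = 0" by (simp add: rank_def N_def)
      then show False using rank_bounds(1)[OF that(2), of h] by simp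
    qed
    moreover have "(h w - hole h - 1) mod N < N" using N by simp
    ultimately have r: "(h w - hole h - 1) mod N < N - 1" by simp
    have "h w - hole h - 1 = N * p w + (h w - hole h - 1) mod N" by (simp add: p_def)
    then have "h v - hole h - 1 < N * (p w + c + 1)"
      using that(1) r by (simp add: algebra_simps)
    moreover have "N * p v \<le> h v - hole h - 1"
      using mult_div_mod_eq[of N "h v - hole h - 1"] pos_mod_sign[OF N, of "h v - hole h - 1"]
      unfolding p_def by linarith
    ultimately have "N * p v < N * (p w + c + 1)" by linarith
    then show ?thesis using N by simp
  qed
  \<comment> \<open>The potential difference is a subgradient at \<open>x a\<close> of
    \<open>\<bar>_ - y a\<bar>\<close> on the integers between \<open>0\<close> and
    \<open>u a\<close>. Summed over all arcs, the left-hand sides vanish because \<open>x\<close>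
    and \<open>z\<close> are circulations.\<close>
  have key: "(p (hd a) - p (tl a)) * (x a - z a) \<le> \<bar>z a - y a\<bar> - \<bar>x a - y a\<bar>" if a: "a < m" for a
  proof -
    let ?d = "p (tl a) - p (hd a)"
    have f: "x a < u a \<Longrightarrow> ?d \<le> (if x a < y a then -1 else 1)"
    proof -
      assume "x a < u a"
      then have "-1 \<le> red_forw y x h a" using opt a by (simp add: eps_opt_def)
      then have "h (tl a) \<le> h (hd a) + N * (if x a < y a then -1 else 1) + 1"
        unfolding red_forw_def N_def by linarith
      from round[OF this hd_less[OF a]] show ?thesis by simp
    qed
    have b: "0 < x a \<Longrightarrow> - ?d \<le> (if x a \<le> y a then 1 else -1)"
    proof -
      assume "0 < x a"
      then have "-1 \<le> red_back y x h a" using opt a by (simp add: eps_opt_def)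
      then have "h (hd a) \<le> h (tl a) + N * (if x a \<le> y a then 1 else -1) + 1"
        unfolding red_back_def N_def by linarith
      from round[OF this tl_less[OF a]] show ?thesis by simp
    qed
    have bounds: "0 \<le> z a" "z a \<le> u a" using z(1)[OF a] by auto
    consider "x a < z a" | "z a < x a" | "z a = x a" by linarith
    then have "?d * (z a - x a) \<le> \<bar>z a - y a\<bar> - \<bar>x a - y a\<bar>"
    proof cases
      case 1
      then have "?d * (z a - x a) \<le> (if x a < y a then -1 else 1) * (z a - x a)"
        using f bounds by (intro mult_right_mono) auto
      also have "\<dots> \<le> \<bar>z a - y a\<bar> - \<bar>x a - y a\<bar>" using 1 by auto
      finally show ?thesis .
    next
      case 2
      then have "- ?d * (x a - z a) \<le> (if x a \<le> y a then 1 else -1) * (x a - z a)"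
        using b bounds by (intro mult_right_mono) auto
      also have "\<dots> \<le> \<bar>z a - y a\<bar> - \<bar>x a - y a\<bar>" using 2 by auto
      finally show ?thesis by (simp add: algebra_simps)
    qed simp
    then show ?thesis by (simp add: algebra_simps)
  qed
  have "0 = (\<Sum>v<n. p v * excess x v) - (\<Sum>v<n. p v * excess z v)"
    using x z(2) by simp
  also have "\<dots> = (\<Sum>a<m. (p (hd a) - p (tl a)) * (x a - z a))"
    unfolding sum_excess by (simp add: sum_subtractf[symmetric] algebra_simps)
  also have "\<dots> \<le> (\<Sum>a<m. \<bar>z a - y a\<bar> - \<bar>x a - y a\<bar>)"
    using key by (intro sum_mono) auto
  finally show ?thesis by (simp add: sum_subtractf)
qed

end

section \<open>The scaling algorithm\<close>

text \<open>
  \<open>FX\<close> (the output), \<open>HX\<close>, \<open>UX\<close>, \<open>YX\<close>: flow, heights, capacities, target flow; \<open>IN\<close>, \<open>OUT\<close>: units received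
  and sent by the nodes. Registers: \<open>RS\<close> is the total capacity, \<open>RD\<close> the scaling factor, \<open>RL\<close> the number of phases,
  \<open>RN1\<close>, \<open>RQ\<close>, \<open>RM1\<close>, \<open>RL1\<close> are \<open>n + 1\<close>, \<open>n + 2\<close>, \<open>m + 1\<close>, \<open>RL + 1\<close>; \<open>FL\<close> records whether a scan has pushed;
  \<open>CA\<close>, \<open>CV\<close>, \<open>CP\<close> are the current arc, node and phase.
\<close>

abbreviation (input) "FX \<equiv> 1 :: nat"
abbreviation (input) "HX \<equiv> 2 :: nat"
abbreviation (input) "IN \<equiv> 3 :: nat"
abbreviation (input) "OUT \<equiv> 4 :: nat"
abbreviation (input) "TL \<equiv> 5 :: nat"
abbreviation (input) "HD \<equiv> 6 :: nat"
abbreviation (input) "UX \<equiv> 7 :: nat"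
abbreviation (input) "YX \<equiv> 8 :: nat"
abbreviation (input) "RN \<equiv> 9 :: nat"
abbreviation (input) "RM \<equiv> 10 :: nat"
abbreviation (input) "RS \<equiv> 11 :: nat"
abbreviation (input) "RD \<equiv> 12 :: nat"
abbreviation (input) "RL \<equiv> 13 :: nat"
abbreviation (input) "RN1 \<equiv> 14 :: nat"
abbreviation (input) "RQ \<equiv> 15 :: nat"
abbreviation (input) "RM1 \<equiv> 16 :: nat"
abbreviation (input) "RL1 \<equiv> 17 :: nat"
abbreviation (input) "FL \<equiv> 18 :: nat"
abbreviation (input) "CA \<equiv> 19 :: nat"
abbreviation (input) "CV \<equiv> 20 :: nat"
abbreviation (input) "CP \<equiv> 21 :: nat"

abbreviation reg :: "nat \<Rightarrow> expr" where
  "reg r \<equiv> Load r (Const 0)"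

abbreviation For :: "nat \<Rightarrow> nat \<Rightarrow> prog \<Rightarrow> prog" where
  "For c r p \<equiv> Loop False c (reg r) p"

definition "arc_tl = Load TL (reg CA)"
definition "arc_hd = Load HD (reg CA)"
definition "arc_flow = Load FX (reg CA)"
definition "arc_cap = Divide (Load UX (reg CA)) (reg RD)"
definition "arc_nom = Divide (Load YX (reg CA)) (reg RD)"
definition "active = LessE (Load OUT (reg CV)) (Load IN (reg CV))"

text \<open>Reduced costs below \<open>-k\<close> and below \<open>0\<close>, with the negative terms moved to the other side.\<close>

definition forw_below :: "nat \<Rightarrow> expr" where
  "forw_below k = LessE (Plus (Plus (Load HX arc_hd) (reg RN1)) (Const k))
     (Plus (Load HX arc_tl) (AndE (LessE arc_flow arc_nom) (Plus (reg RN1) (reg RN1))))"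

definition back_below :: expr where
  "back_below = LessE (Plus (Load HX arc_tl) (reg RN1))
     (Plus (Load HX arc_hd) (AndE (LessE arc_nom arc_flow) (Plus (reg RN1) (reg RN1))))"

definition incr :: "nat \<Rightarrow> expr \<Rightarrow> prog" where
  "incr r e = Asg r e (Plus (Load r e) (Const 1))"

definition dbl :: "nat \<Rightarrow> expr \<Rightarrow> prog" where
  "dbl r e = Asg r e (Plus (Load r e) (Load r e))"

definition push_forw :: prog where
  "push_forw = incr FX (reg CA) ;; incr OUT arc_tl ;; incr IN arc_hd"

text \<open>
  Only the difference of \<open>IN\<close> and \<open>OUT\<close> matters: counting the unit taken back from an arc as a unit
  leaving its head avoids truncated subtraction.
\<close>

definition push_back :: prog where
  "push_back = Asg FX (reg CA) (Minus arc_flow (Const 1)) ;; incr OUT arc_hd ;; incr IN arc_tl"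

definition scan_arc :: prog where
  "scan_arc =
     Branch (AndE active (AndE (EqE arc_tl (reg CV)) (AndE (LessE arc_flow arc_cap) (forw_below 0))))
       (push_forw ;; Asg FL (Const 0) (Const 1))
       (Branch (AndE active (AndE (EqE arc_hd (reg CV)) (AndE arc_flow back_below)))
         (push_back ;; Asg FL (Const 0) (Const 1)) Nop)"

text \<open>An arc that has just carried a unit may admit another one, so a node is relabelled only
  after a scan without pushes.\<close>

definition process_node :: prog where
  "process_node = Asg FL (Const 0) (Const 0) ;; For CA RM scan_arc ;;
     Branch (AndE active (NotE (reg FL))) (incr HX (reg CV)) Nop"

definition sweep :: prog where
  "sweep = For CV RN process_node"

text \<open>The number of sweeps, \<open>(n + 2)\<^sup>4 (m + 1) (L + 1)\<close>, exceeds the initial weight of a phase.\<close>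

definition discharge :: prog where
  "discharge = For 22 RQ (For 23 RQ (For 24 RQ (For 25 RQ (For 26 RM1 (For 27 RL1 sweep)))))"

text \<open>\<open>IN\<close> and \<open>OUT\<close> are doubled together with the flow, so that
  their difference remains the excess. The refinement is then a conditional push on every
  arc.\<close>

definition phase :: prog where
  "phase = Asg RD (Const 0) (Divide (reg RD) (Const 2)) ;;
     For CA RM (dbl FX (reg CA)) ;;
     For CV RN (dbl IN (reg CV) ;; dbl OUT (reg CV)) ;;
     For CA RM (Branch (AndE (LessE arc_flow arc_cap) (forw_below 1)) push_forw Nop) ;;
     discharge"

definition main_loop :: prog where
  "main_loop = For CP RL phase"

section \<open>Correctness of a phase\<close>

definition cap :: "(nat \<Rightarrow> nat) \<Rightarrow> nat \<Rightarrow> nat \<Rightarrow> int" where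
  "cap f D a = int (f a div D)"

definition ints :: "(nat \<Rightarrow> nat) \<Rightarrow> nat \<Rightarrow> int" where
  "ints f a = int (f a)"

lemma ints_upd [simp]: "ints (f(a := k)) = (ints f)(a := int k)"
  by (auto simp: ints_def)

locale flow_program = network n m tl hd for n m tl hd +
  fixes u y :: "nat \<Rightarrow> nat" and L :: nat
begin

definition env :: "nat \<Rightarrow> store \<Rightarrow> bool" where
  "env D \<sigma> \<longleftrightarrow> \<sigma> TL = tl \<and> \<sigma> HD = hd \<and> \<sigma> UX = u \<and> \<sigma> YX = y \<and> \<sigma> RN 0 = n \<and> \<sigma> RM 0 = m \<and>
     \<sigma> RL 0 = L \<and> \<sigma> RN1 0 = n + 1 \<and> \<sigma> RQ 0 = n + 2 \<and> \<sigma> RM1 0 = m + 1 \<and> \<sigma> RL1 0 = L + 1 \<and> \<sigma> RD 0 = D"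

definition counted :: "store \<Rightarrow> bool" where
  "counted \<sigma> \<longleftrightarrow> (\<forall>v<n. int (\<sigma> IN v) - int (\<sigma> OUT v) = excess (ints (\<sigma> FX)) v)"

definition good :: "nat \<Rightarrow> int \<Rightarrow> store \<Rightarrow> bool" where
  "good D R \<sigma> \<longleftrightarrow> env D \<sigma> \<and> counted \<sigma> \<and> invariant (cap u D) (cap y D) R (ints (\<sigma> FX)) (ints (\<sigma> HX))"

abbreviation wt :: "int \<Rightarrow> store \<Rightarrow> int" where
  "wt R \<sigma> \<equiv> weight R (ints (\<sigma> FX)) (ints (\<sigma> HX))"

lemma env_put [simp]: "r < 5 \<or> 17 < r \<Longrightarrow> env D (put r i k \<sigma>) = env D \<sigma>"
  by (auto simp: env_def)

lemma counted_put [simp]: "4 < r \<Longrightarrow> counted (put r i k \<sigma>) = counted \<sigma>"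
  by (auto simp: counted_def)

lemma good_put [simp]: "17 < r \<Longrightarrow> good D R (put r i k \<sigma>) = good D R \<sigma>"
  by (auto simp: good_def)

lemma arc_vals:
  assumes "env D \<sigma>" "\<sigma> CA 0 = a"
  shows "val arc_tl \<sigma> = tl a" "val arc_hd \<sigma> = hd a" "val arc_flow \<sigma> = \<sigma> FX a"
    "int (val arc_cap \<sigma>) = cap u D a" "int (val arc_nom \<sigma>) = cap y D a"
  using assms by (auto simp: arc_tl_def arc_hd_def arc_flow_def arc_cap_def arc_nom_def env_def cap_def)

lemma val_forw_below:
  assumes "env D \<sigma>" "\<sigma> CA 0 = a"
  shows "val (forw_below k) \<sigma> = 0 \<longleftrightarrow> - int k \<le> red_forw (cap y D) (ints (\<sigma> FX)) (ints (\<sigma> HX)) a"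
proof -
  have "\<sigma> FX a < val arc_nom \<sigma> \<longleftrightarrow> ints (\<sigma> FX) a < cap y D a"
    by (auto simp: ints_def simp flip: arc_vals(5)[OF assms])
  moreover have "\<sigma> RN1 0 = n + 1" using assms by (simp add: env_def)
  ultimately show ?thesis
    by (auto simp: forw_below_def arc_vals[OF assms] red_forw_def ints_def of_bool_def)
qed

lemma val_back_below:
  assumes "env D \<sigma>" "\<sigma> CA 0 = a"
  shows "val back_below \<sigma> = 0 \<longleftrightarrow> 0 \<le> red_back (cap y D) (ints (\<sigma> FX)) (ints (\<sigma> HX)) a"
proof -
  have "val arc_nom \<sigma> < \<sigma> FX a \<longleftrightarrow> \<not> ints (\<sigma> FX) a \<le> cap y D a"
    by (auto simp: ints_def simp flip: arc_vals(5)[OF assms])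
  moreover have "\<sigma> RN1 0 = n + 1" using assms by (simp add: env_def)
  ultimately show ?thesis
    by (auto simp: back_below_def arc_vals[OF assms] red_back_def ints_def of_bool_def)
qed

lemma arc_residual:
  assumes "env D \<sigma>" "\<sigma> CA 0 = a"
  shows "\<sigma> FX a < val arc_cap \<sigma> \<longleftrightarrow> ints (\<sigma> FX) a < cap u D a"
  by (simp add: ints_def flip: arc_vals(4)[OF assms])

lemma val_active:
  assumes "counted \<sigma>" "\<sigma> CV 0 = v" "v < n"
  shows "val active \<sigma> = 0 \<longleftrightarrow> excess (ints (\<sigma> FX)) v \<le> 0"
  using assms by (auto simp: active_def counted_def)

lemma push_forw_sem:
  assumes "env D \<sigma>" "counted \<sigma>" "\<sigma> CA 0 = a" "a < m"
  shows "ints (sem push_forw \<sigma> FX) = (ints (\<sigma> FX))(a := ints (\<sigma> FX) a + 1)"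
    "sem push_forw \<sigma> FX = (\<sigma> FX)(a := Suc (\<sigma> FX a))"
    "env D (sem push_forw \<sigma>)" "counted (sem push_forw \<sigma>)"
proof -
  have s: "\<sigma> TL = tl" "\<sigma> HD = hd" using assms by (auto simp: env_def)
  have e: "sem push_forw \<sigma> = put IN (hd a) (\<sigma> IN (hd a) + 1) (put OUT (tl a) (\<sigma> OUT (tl a) + 1) (put FX a (\<sigma> FX a + 1) \<sigma>))"
    using assms s by (simp add: push_forw_def incr_def arc_tl_def arc_hd_def)
  show x: "ints (sem push_forw \<sigma> FX) = (ints (\<sigma> FX))(a := ints (\<sigma> FX) a + 1)"
    unfolding e by (auto simp: ints_def)
  show "sem push_forw \<sigma> FX = (\<sigma> FX)(a := Suc (\<sigma> FX a))"
    unfolding e by (simp add: fun_eq_iff)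
  show "env D (sem push_forw \<sigma>)" unfolding e using assms(1) by simp
  show "counted (sem push_forw \<sigma>)"
    unfolding counted_def x excess_upd[OF assms(4)] unfolding e
    using assms(2) by (auto simp: counted_def)
qed

lemma push_back_sem:
  assumes "env D \<sigma>" "counted \<sigma>" "\<sigma> CA 0 = a" "a < m" "0 < \<sigma> FX a"
  shows "ints (sem push_back \<sigma> FX) = (ints (\<sigma> FX))(a := ints (\<sigma> FX) a - 1)"
    "env D (sem push_back \<sigma>)" "counted (sem push_back \<sigma>)"
proof -
  have s: "\<sigma> TL = tl" "\<sigma> HD = hd" using assms by (auto simp: env_def)
  have e: "sem push_back \<sigma> = put IN (tl a) (\<sigma> IN (tl a) + 1) (put OUT (hd a) (\<sigma> OUT (hd a) + 1) (put FX a (\<sigma> FX a - 1) \<sigma>))"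
    using assms s by (simp add: push_back_def incr_def arc_tl_def arc_hd_def arc_flow_def)
  show x: "ints (sem push_back \<sigma> FX) = (ints (\<sigma> FX))(a := ints (\<sigma> FX) a - 1)"
    unfolding e using assms(5) by (auto simp: ints_def)
  show "env D (sem push_back \<sigma>)" unfolding e using assms(1) by simp
  show "counted (sem push_back \<sigma>)"
    unfolding counted_def x using excess_upd[OF assms(4), of "ints (\<sigma> FX)" "-1"] unfolding e
    using assms(2) by (auto simp: counted_def)
qed

lemma frames [simp]:
  "sem push_forw \<sigma> HX = \<sigma> HX" "sem push_back \<sigma> HX = \<sigma> HX"
  "sem push_forw \<sigma> CV = \<sigma> CV" "sem push_back \<sigma> CV = \<sigma> CV"
  by (rule sem_frame; simp add: push_forw_def push_back_def incr_def)+

definition blocked :: "nat \<Rightarrow> nat \<Rightarrow> nat \<Rightarrow> (nat \<Rightarrow> int) \<Rightarrow> (nat \<Rightarrow> int) \<Rightarrow> bool" where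
  "blocked D v a x h \<longleftrightarrow>
     (tl a = v \<and> x a < cap u D a \<longrightarrow> 0 \<le> red_forw (cap y D) x h a) \<and>
     (hd a = v \<and> 0 < x a \<longrightarrow> 0 \<le> red_back (cap y D) x h a)"

lemma scan_arc_sem:
  assumes g: "good D R \<sigma>" and a: "\<sigma> CA 0 = a" "a < m" and v: "\<sigma> CV 0 = v" "v < n"
  shows "sem scan_arc \<sigma> = \<sigma> \<and> (0 < excess (ints (\<sigma> FX)) v \<longrightarrow> blocked D v a (ints (\<sigma> FX)) (ints (\<sigma> HX))) \<or>
    0 < excess (ints (\<sigma> FX)) v \<and> good D R (sem scan_arc \<sigma>) \<and> wt R (sem scan_arc \<sigma>) < wt R \<sigma> \<and>
      sem scan_arc \<sigma> FL 0 = 1"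
    (is "?idle \<or> ?push")
proof -
  have e: "env D \<sigma>" and c: "counted \<sigma>"
    and inv: "invariant (cap u D) (cap y D) R (ints (\<sigma> FX)) (ints (\<sigma> HX))"
    using g by (auto simp: good_def)
  let ?x = "ints (\<sigma> FX)"
  let ?h = "ints (\<sigma> HX)"
  let ?F = "0 < excess ?x v \<and> tl a = v \<and> ?x a < cap u D a \<and> red_forw (cap y D) ?x ?h a < 0"
  let ?B = "0 < excess ?x v \<and> hd a = v \<and> 0 < ?x a \<and> red_back (cap y D) ?x ?h a < 0"
  have F: "val (AndE active (AndE (EqE arc_tl (reg CV)) (AndE (LessE arc_flow arc_cap) (forw_below 0)))) \<sigma> \<noteq> 0 \<longleftrightarrow> ?F"
    using v a(1) by (simp add: val_active[OF c v] arc_vals[OF e a(1)] arc_residual[OF e a(1)] val_forw_below[OF e a(1)])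
      (auto simp: not_le arc_residual[OF e refl])
  have B: "val (AndE active (AndE (EqE arc_hd (reg CV)) (AndE arc_flow back_below))) \<sigma> \<noteq> 0 \<longleftrightarrow> ?B"
    using v a(1) by (simp add: val_active[OF c v] arc_vals[OF e a(1)] val_back_below[OF e a(1)])
      (auto simp: not_le ints_def)
  consider ?F | "\<not> ?F" ?B | "\<not> ?F" "\<not> ?B" by blast
  then show ?thesis
  proof cases
    case 1
    then have s: "sem scan_arc \<sigma> = put FL 0 1 (sem push_forw \<sigma>)"
      unfolding scan_arc_def sem.simps F by simp
    note p = push_forw_sem[OF e c a]
    have i: "invariant (cap u D) (cap y D) R (?x(a := ?x a + 1)) ?h" "weight R (?x(a := ?x a + 1)) ?h < weight R ?x ?h"
      using push_forw_invariant[OF inv a(2)] 1 by auto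
    have "good D R (sem push_forw \<sigma>)"
      using p i by (simp add: good_def)
    then have ?push using 1 i(2) unfolding s by (simp add: p(1))
    then show ?thesis ..
  next
    case 2
    have s: "sem scan_arc \<sigma> = put FL 0 1 (sem push_back \<sigma>)"
      unfolding scan_arc_def sem.simps F B by (simp only: if_not_P[OF 2(1)] if_P[OF 2(2)] val.simps)
    have "0 < \<sigma> FX a" using 2 by (simp add: ints_def)
    note p = push_back_sem[OF e c a this]
    have i: "invariant (cap u D) (cap y D) R (?x(a := ?x a - 1)) ?h" "weight R (?x(a := ?x a - 1)) ?h < weight R ?x ?h"
      using push_back_invariant[OF inv a(2)] 2 by auto
    have "good D R (sem push_back \<sigma>)"
      using p i by (simp add: good_def)
    then have ?push using 2 i(2) unfolding s by (simp add: p(1))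
    then show ?thesis ..
  next
    case 3
    have "sem scan_arc \<sigma> = \<sigma>"
      unfolding scan_arc_def sem.simps F B by (simp only: if_not_P[OF 3(1)] if_not_P[OF 3(2)])
    then have ?idle using 3 by (auto simp: blocked_def not_less)
    then show ?thesis ..
  qed
qed

lemma process_node_sem:
  assumes g: "good D R \<sigma>" and v: "\<sigma> CV 0 = v" "v < n"
  defines "\<sigma>' \<equiv> sem process_node \<sigma>"
  shows "good D R \<sigma>' \<and>
    (ints (\<sigma>' FX) = ints (\<sigma> FX) \<and> ints (\<sigma>' HX) = ints (\<sigma> HX) \<and> excess (ints (\<sigma> FX)) v \<le> 0 \<or>
     0 < excess (ints (\<sigma> FX)) v \<and> wt R \<sigma>' < wt R \<sigma>)"
proof -
  let ?x = "ints (\<sigma> FX)"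
  let ?h = "ints (\<sigma> HX)"
  let ?\<sigma> = "put FL 0 0 \<sigma>"
  define \<rho> where "\<rho> = sem (For CA RM scan_arc) ?\<sigma>"
  \<comment> \<open>As long as \<open>FL\<close> is \<open>0\<close>, flow and heights are the
    initial ones, so the facts \<open>blocked\<close> collected so far refer to the same state.
    After a push only the smaller weight matters.\<close>
  define I where "I k \<rho> \<longleftrightarrow> good D R \<rho> \<and> \<rho> CV 0 = v \<and>
    (\<rho> FL 0 = 0 \<and> ints (\<rho> FX) = ?x \<and> ints (\<rho> HX) = ?h \<and>
       (0 < excess ?x v \<longrightarrow> (\<forall>a. k \<le> a \<and> a < m \<longrightarrow> blocked D v a ?x ?h)) \<or>
     \<rho> FL 0 = 1 \<and> 0 < excess ?x v \<and> wt R \<rho> < wt R \<sigma>)" for k \<rho>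
  have m: "val (reg RM) ?\<sigma> = m" using g by (simp add: good_def env_def)
  have "I 0 \<rho>"
    unfolding \<rho>_def
  proof (rule loop_rule[where I = I, OF _ _ _ refl])
    show "CA \<notin> writes scan_arc"
      by (simp add: scan_arc_def push_forw_def push_back_def incr_def)
    show "I (val (reg RM) ?\<sigma>) (put CA 0 (val (reg RM) ?\<sigma>) ?\<sigma>)"
      unfolding m using g v by (auto simp: I_def)
    fix k \<rho> assume k: "k < val (reg RM) ?\<sigma>" and I: "I (Suc k) \<rho>"
    let ?\<rho> = "put CA 0 k \<rho>"
    have r: "good D R ?\<rho>" "?\<rho> CA 0 = k" "k < m" "?\<rho> CV 0 = v"
      using I k unfolding m by (auto simp: I_def)
    have cv: "sem scan_arc ?\<rho> CV = \<rho> CV"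
      by (subst sem_frame) (simp_all add: scan_arc_def push_forw_def push_back_def incr_def)
    show "I k (sem scan_arc ?\<rho>)"
      using scan_arc_sem[OF r v(2)]
    proof (elim disjE conjE)
      assume 1: "sem scan_arc ?\<rho> = ?\<rho>"
        "0 < excess (ints (?\<rho> FX)) v \<longrightarrow> blocked D v k (ints (?\<rho> FX)) (ints (?\<rho> HX))"
      have "\<forall>a. k \<le> a \<and> a < m \<longrightarrow> blocked D v a ?x ?h"
        if "\<forall>a. Suc k \<le> a \<and> a < m \<longrightarrow> blocked D v a ?x ?h" "blocked D v k ?x ?h"
        using that by (metis Suc_leI le_neq_implies_less)
      then show ?thesis using I 1 r(1) unfolding I_def 1(1) by auto
    next
      assume 2: "0 < excess (ints (?\<rho> FX)) v" "good D R (sem scan_arc ?\<rho>)"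
        "wt R (sem scan_arc ?\<rho>) < wt R ?\<rho>" "sem scan_arc ?\<rho> FL 0 = 1"
      then show ?thesis using I cv unfolding I_def by auto
    qed
  qed
  then have I: "good D R \<rho>" "\<rho> CV 0 = v"
    "\<rho> FL 0 = 0 \<and> ints (\<rho> FX) = ?x \<and> ints (\<rho> HX) = ?h \<and>
       (0 < excess ?x v \<longrightarrow> (\<forall>a<m. blocked D v a ?x ?h)) \<or>
     \<rho> FL 0 = 1 \<and> 0 < excess ?x v \<and> wt R \<rho> < wt R \<sigma>"
    by (auto simp: I_def)
  have c: "counted \<rho>" using I(1) by (simp add: good_def)
  have s: "\<sigma>' = (if 0 < excess (ints (\<rho> FX)) v \<and> \<rho> FL 0 = 0 then sem (incr HX (reg CV)) \<rho> else \<rho>)"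
    unfolding \<sigma>'_def process_node_def sem.simps(3) sem.simps(4) 
    by (simp add: \<rho>_def[symmetric] val_active[OF c I(2) v(2)] del: sem.simps(5))
  from I(3) show ?thesis
  proof (elim disjE conjE)
    assume 1: "\<rho> FL 0 = 0" "ints (\<rho> FX) = ?x" "ints (\<rho> HX) = ?h"
      "0 < excess ?x v \<longrightarrow> (\<forall>a<m. blocked D v a ?x ?h)"
    show ?thesis
    proof (cases "0 < excess ?x v")
      case True
      have "invariant (cap u D) (cap y D) R ?x ?h" using g by (simp add: good_def)
      then have i: "invariant (cap u D) (cap y D) R ?x (?h(v := ?h v + 1))"
        "weight R ?x (?h(v := ?h v + 1)) < weight R ?x ?h"
        using relabel_invariant[of "cap u D" "cap y D" R ?x ?h v] v(2) True 1(4) by (auto simp: blocked_def)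
      have "\<sigma>' = put HX v (\<rho> HX v + 1) \<rho>"
        using s True 1 I(2) by (simp add: incr_def)
      moreover have "ints ((\<rho> HX)(v := \<rho> HX v + 1)) = ?h(v := ?h v + 1)"
        using 1(3) by (metis ints_def ints_upd of_nat_1 of_nat_add)
      moreover have "counted (put HX v (\<rho> HX v + 1) \<rho>)"
        using c by (simp add: counted_def)
      ultimately show ?thesis
        using i True I(1) 1(2) by (simp add: good_def del: ints_upd)
    next
      case False
      then show ?thesis using s 1 I(1) by simp
    qed
  next
    assume 2: "\<rho> FL 0 = 1" "0 < excess ?x v" "wt R \<rho> < wt R \<sigma>"
    then show ?thesis using s I(1) by simp
  qed
qed

lemma writes_process_node:
  "writes process_node = {FX, HX, IN, OUT, FL, CA}"
  by (auto simp: process_node_def scan_arc_def push_forw_def push_back_def incr_def)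

text \<open>Inactive nodes leave flow and heights alone. Hence the first active node that the sweep
  meets was active from the start, and processing it lowers the weight.\<close>

lemma sweep_sem:
  assumes g: "good D R \<sigma>"
  defines "\<sigma>' \<equiv> sem sweep \<sigma>"
  shows "good D R \<sigma>' \<and>
    (ints (\<sigma>' FX) = ints (\<sigma> FX) \<and> (\<forall>v<n. excess (ints (\<sigma> FX)) v \<le> 0) \<or>
     (\<exists>v<n. 0 < excess (ints (\<sigma> FX)) v) \<and> wt R \<sigma>' < wt R \<sigma>)"
proof -
  let ?x = "ints (\<sigma> FX)"
  let ?h = "ints (\<sigma> HX)"
  define I where "I k \<rho> \<longleftrightarrow> good D R \<rho> \<and>
    (ints (\<rho> FX) = ?x \<and> ints (\<rho> HX) = ?h \<and> (\<forall>v. k \<le> v \<and> v < n \<longrightarrow> excess ?x v \<le> 0) \<or>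
     (\<exists>v<n. 0 < excess ?x v) \<and> wt R \<rho> < wt R \<sigma>)" for k \<rho>
  have n: "val (reg RN) \<sigma> = n" using g by (simp add: good_def env_def)
  have "I 0 \<sigma>'"
    unfolding \<sigma>'_def sweep_def
  proof (rule loop_rule[where I = I, OF _ _ _ refl])
    show "CV \<notin> writes process_node"
      by (simp add: writes_process_node)
    show "I (val (reg RN) \<sigma>) (put CV 0 (val (reg RN) \<sigma>) \<sigma>)"
      unfolding n using g by (simp add: I_def)
    fix k \<rho> assume k: "k < val (reg RN) \<sigma>" and I: "I (Suc k) \<rho>"
    let ?\<rho> = "put CV 0 k \<rho>"
    have r: "good D R ?\<rho>" "?\<rho> CV 0 = k" "k < n"
      using I k unfolding n by (auto simp: I_def)
    have *: "\<forall>v. k \<le> v \<and> v < n \<longrightarrow> excess ?x v \<le> 0"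
        if "\<forall>v. Suc k \<le> v \<and> v < n \<longrightarrow> excess ?x v \<le> 0" "excess ?x k \<le> 0"
        using that by (metis Suc_leI le_neq_implies_less)
    show "I k (sem process_node ?\<rho>)"
      using process_node_sem[OF r] I * r(3) unfolding I_def by auto
  qed
  then show ?thesis by (auto simp: I_def)
qed

text \<open>The weight alone may stay positive when no node is active. With the value
  \<open>0\<close> in that case, surplus sweeps agree with the truncated subtraction in
  \<open>progress\<close>.\<close>

definition work :: "int \<Rightarrow> store \<Rightarrow> nat" where
  "work R \<sigma> = (if \<exists>v<n. 0 < excess (ints (\<sigma> FX)) v then nat (wt R \<sigma>) else 0)"

definition progress :: "nat \<Rightarrow> prog \<Rightarrow> bool" where
  "progress d p \<longleftrightarrow> (\<forall>D R \<sigma>. good D R \<sigma> \<longrightarrow> good D R (sem p \<sigma>) \<and> work R (sem p \<sigma>) \<le> work R \<sigma> - d)"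

lemma progress_sweep: "progress 1 sweep"
  unfolding progress_def
proof (intro allI impI)
  fix D R \<sigma> assume g: "good D R \<sigma>"
  note s = sweep_sem[OF g]
  show "good D R (sem sweep \<sigma>) \<and> work R (sem sweep \<sigma>) \<le> work R \<sigma> - 1"
  proof (cases "\<exists>v<n. 0 < excess (ints (\<sigma> FX)) v")
    case True
    then have "0 < wt R \<sigma>"
      using g weight_pos by (auto simp: good_def)
    moreover have "wt R (sem sweep \<sigma>) < wt R \<sigma>"
      using s True by force
    ultimately show ?thesis using s True by (auto simp: work_def)
  next
    case False
    then show ?thesis using s by (auto simp: work_def)
  qed
qed

text \<open>Nested loops multiply their progress, so a product of registers bounds the work although
  the program never computes this product.\<close>

lemma progress_For:
  assumes "progress d p" "c \<notin> writes p" "17 < c" "\<And>D \<sigma>. env D \<sigma> \<Longrightarrow> \<sigma> r 0 = k"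
  shows "progress (k * d) (For c r p)"
  unfolding progress_def
proof (intro allI impI)
  fix D R \<sigma> assume g: "good D R \<sigma>"
  then have "env D \<sigma>" by (simp add: good_def)
  from assms(4)[OF this] have k: "val (reg r) \<sigma> = k" by simp
  have put: "work R (put c i j \<sigma>) = work R \<sigma>" for i j \<sigma>
  proof -
    have "put c i j \<sigma> FX = \<sigma> FX" "put c i j \<sigma> HX = \<sigma> HX" using assms(3) by simp_all
    then show ?thesis by (simp only: work_def)
  qed
  define I where "I j \<rho> \<longleftrightarrow> good D R \<rho> \<and> j \<le> k \<and> work R \<rho> \<le> work R \<sigma> - (k - j) * d" for j \<rho>
  have "I 0 (sem (For c r p) \<sigma>)"
  proof (rule loop_rule[where I = I, OF assms(2) _ _ refl])
    show "I (val (reg r) \<sigma>) (put c 0 (val (reg r) \<sigma>) \<sigma>)"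
      unfolding k using g assms(3) by (simp add: I_def put)
    fix j \<rho> assume j: "j < val (reg r) \<sigma>" "I (Suc j) \<rho>"
    have "good D R (put c 0 j \<rho>)"
      using j(2) assms(3) by (simp add: I_def)
    then have "good D R (sem p (put c 0 j \<rho>))" "work R (sem p (put c 0 j \<rho>)) \<le> work R (put c 0 j \<rho>) - d"
      using assms(1) unfolding progress_def by blast+
    moreover have "work R \<rho> \<le> work R \<sigma> - (k - Suc j) * d"
      using j(2) by (simp add: I_def)
    moreover have "k - j = Suc (k - Suc j)"
      using j(1) k by simp
    then have "(k - j) * d = (k - Suc j) * d + d"
      by simp
    ultimately show "I j (sem p (put c 0 j \<rho>))"
      using j k by (simp add: I_def put)
  qed
  then show "good D R (sem (For c r p) \<sigma>) \<and> work R (sem (For c r p) \<sigma>) \<le> work R \<sigma> - k * d"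
    by (simp add: I_def)
qed

lemma writes_sweep: "writes sweep = {FX, HX, IN, OUT, FL, CA, CV}"
  by (auto simp: sweep_def writes_process_node)

lemma progress_discharge:
  "progress ((n + 2) * ((n + 2) * ((n + 2) * ((n + 2) * ((m + 1) * ((L + 1) * 1)))))) discharge"
  unfolding discharge_def
  by (intro progress_For progress_sweep) (auto simp: writes_sweep env_def)

lemma discharge_sem:
  assumes g: "good D R \<sigma>" and h: "R + int n * (int n + 2) \<le> int (L * n * (n + 2))"
  shows "good D R (sem discharge \<sigma>)" "\<And>v. v < n \<Longrightarrow> excess (ints (sem discharge \<sigma> FX)) v = 0"
proof -
  let ?q = "n + 2"
  let ?K = "?q * (?q * (?q * (?q * ((m + 1) * ((L + 1) * 1)))))"
  have *: "good D R (sem discharge \<sigma>)" "work R (sem discharge \<sigma>) \<le> work R \<sigma> - ?K"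
    using progress_discharge g unfolding progress_def by blast+
  show "good D R (sem discharge \<sigma>)" by fact
  have "wt R \<sigma> \<le> (int m * int n + 1) * (int n * (R + int n * (int n + 2))) + int m * int n"
    using g by (intro weight_le) (auto simp: good_def ints_def)
  also have "\<dots> \<le> (int m * int n + 1) * (int n * int (L * n * ?q)) + int m * int n"
    using h by (intro add_mono mult_left_mono) auto
  also have "\<dots> = int ((m * n + 1) * (n * (L * n * ?q)) + m * n)"
    by (simp add: algebra_simps)
  finally have "nat (wt R \<sigma>) \<le> (m * n + 1) * (n * (L * n * ?q)) + m * n"
    by linarith
  \<comment> \<open>With \<open>q = n + 2\<close> and \<open>p = m + 1\<close>, the first summand is
    at most \<open>p * L * q ^ 4\<close>, from \<open>m * n + 1 \<le> p * q\<close> and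
    \<open>n * (L * n * q) \<le> L * q ^ 3\<close>. The summand \<open>m * n\<close> accounts for
    the \<open>1\<close> in \<open>L + 1\<close>.\<close>
  also have "\<dots> \<le> ?K"
  proof -
    define q p where "q = n + 2" and "p = m + 1"
    have n: "n \<le> q" and q: "1 \<le> q" and mn: "m * n + 1 \<le> p * q"
      by (simp_all add: q_def p_def algebra_simps)
    have "n * (L * n * q) \<le> q * (L * q * q)"
      by (rule mult_le_mono[OF n mult_le_mono1[OF mult_le_mono2[OF n]]])
    then have "(m * n + 1) * (n * (L * n * q)) \<le> p * q * (q * (L * q * q))"
      by (rule mult_le_mono[OF mn])
    moreover have "m * n \<le> p * q * (q * q * q)"
    proof -
      have "1 * 1 * 1 \<le> q * q * q"
        by (intro mult_le_mono q)
      then have "p * q * 1 \<le> p * q * (q * q * q)"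
        by (intro mult_le_mono2) simp
      then show ?thesis using mn by linarith
    qed
    ultimately have "(m * n + 1) * (n * (L * n * q)) + m * n \<le> p * q * (q * (L * q * q)) + p * q * (q * q * q)"
      by (rule add_le_mono)
    also have "\<dots> = q * (q * (q * (q * (p * ((L + 1) * 1)))))"
      by (simp add: algebra_simps)
    finally show ?thesis unfolding q_def p_def .
  qed
  finally have "work R \<sigma> \<le> ?K" by (simp add: work_def)
  then have "work R (sem discharge \<sigma>) = 0" using *(2) by linarith
  then have no: "\<not> 0 < excess (ints (sem discharge \<sigma> FX)) v" if "v < n" for v
    using weight_pos[of "cap u D" "cap y D" R] that *(1)
    by (force simp: work_def good_def split: if_splits)
  then show "excess (ints (sem discharge \<sigma> FX)) v = 0" if "v < n" for v
    using that by (intro balanced_if_no_excess) (auto simp: not_less)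
qed

section \<open>The sequence of scaling phases\<close>

definition settled :: "nat \<Rightarrow> int \<Rightarrow> store \<Rightarrow> bool" where
  "settled D R \<sigma> \<longleftrightarrow> env D \<sigma> \<and> counted \<sigma> \<and> eps_opt (cap u D) (cap y D) (ints (\<sigma> FX)) (ints (\<sigma> HX)) \<and>
     (\<forall>v<n. excess (ints (\<sigma> FX)) v = 0) \<and> (\<forall>v<n. int (\<sigma> HX v) \<le> R)"

lemma double_flow_sem:
  assumes "env D \<sigma>" "\<sigma>' = sem (For CA RM (dbl FX (reg CA))) \<sigma>"
  shows "\<And>a. a < m \<Longrightarrow> \<sigma>' FX a = 2 * \<sigma> FX a" "env D \<sigma>'" "\<sigma>' HX = \<sigma> HX" "\<sigma>' IN = \<sigma> IN" "\<sigma>' OUT = \<sigma> OUT"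
proof -
  have m: "val (reg RM) \<sigma> = m" using assms(1) by (simp add: env_def)
  define I where "I k \<rho> \<longleftrightarrow> env D \<rho> \<and> (\<forall>a<m. \<rho> FX a = (if a < k then \<sigma> FX a else 2 * \<sigma> FX a))" for k \<rho>
  have "I 0 \<sigma>'"
    unfolding assms(2)
  proof (rule loop_rule[where I = I, OF _ _ _ refl])
    show "I (val (reg RM) \<sigma>) (put CA 0 (val (reg RM) \<sigma>) \<sigma>)"
      unfolding m using assms by (simp add: I_def)
    fix k \<rho> assume "k < val (reg RM) \<sigma>" "I (Suc k) \<rho>"
    then show "I k (sem (dbl FX (reg CA)) (put CA 0 k \<rho>))"
      unfolding m by (auto simp: I_def dbl_def less_Suc_eq)
  qed (simp add: dbl_def)
  then show "\<And>a. a < m \<Longrightarrow> \<sigma>' FX a = 2 * \<sigma> FX a" "env D \<sigma>'" by (auto simp: I_def)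
  show "\<sigma>' HX = \<sigma> HX" "\<sigma>' IN = \<sigma> IN" "\<sigma>' OUT = \<sigma> OUT"
    unfolding assms(2) by (subst sem_frame; simp add: dbl_def)+
qed

lemma double_excess_sem:
  assumes "env D \<sigma>" "\<sigma>' = sem (For CV RN (dbl IN (reg CV) ;; dbl OUT (reg CV))) \<sigma>"
  shows "\<And>v. v < n \<Longrightarrow> \<sigma>' IN v = 2 * \<sigma> IN v" "\<And>v. v < n \<Longrightarrow> \<sigma>' OUT v = 2 * \<sigma> OUT v"
    "env D \<sigma>'" "\<sigma>' HX = \<sigma> HX" "\<sigma>' FX = \<sigma> FX"
proof -
  have n: "val (reg RN) \<sigma> = n" using assms(1) by (simp add: env_def)
  define I where "I k \<rho> \<longleftrightarrow> env D \<rho> \<and> (\<forall>v<n. \<rho> IN v = (if v < k then \<sigma> IN v else 2 * \<sigma> IN v) \<and>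
    \<rho> OUT v = (if v < k then \<sigma> OUT v else 2 * \<sigma> OUT v))" for k \<rho>
  have "I 0 \<sigma>'"
    unfolding assms(2)
  proof (rule loop_rule[where I = I, OF _ _ _ refl])
    show "I (val (reg RN) \<sigma>) (put CV 0 (val (reg RN) \<sigma>) \<sigma>)"
      unfolding n using assms by (simp add: I_def)
    fix k \<rho> assume "k < val (reg RN) \<sigma>" "I (Suc k) \<rho>"
    then show "I k (sem (dbl IN (reg CV) ;; dbl OUT (reg CV)) (put CV 0 k \<rho>))"
      unfolding n by (auto simp: I_def dbl_def less_Suc_eq)
  qed (simp add: dbl_def)
  then show "\<And>v. v < n \<Longrightarrow> \<sigma>' IN v = 2 * \<sigma> IN v" "\<And>v. v < n \<Longrightarrow> \<sigma>' OUT v = 2 * \<sigma> OUT v" "env D \<sigma>'"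
    by (auto simp: I_def)
  show "\<sigma>' HX = \<sigma> HX" "\<sigma>' FX = \<sigma> FX"
    unfolding assms(2) by (subst sem_frame; simp add: dbl_def)+
qed

lemma refine_sem:
  assumes "env D \<sigma>" "counted \<sigma>" "\<forall>a<m. ints (\<sigma> FX) a = 2 * x a"
    and "\<sigma>' = sem (For CA RM (Branch (AndE (LessE arc_flow arc_cap) (forw_below 1)) push_forw Nop)) \<sigma>"
  shows "\<And>a. a < m \<Longrightarrow> ints (\<sigma>' FX) a = refined (cap u D) (cap y D) x (ints (\<sigma> HX)) a"
    "env D \<sigma>'" "counted \<sigma>'" "\<sigma>' HX = \<sigma> HX"
proof -
  let ?h = "ints (\<sigma> HX)"
  let ?p = "Branch (AndE (LessE arc_flow arc_cap) (forw_below 1)) push_forw Nop"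
  have m: "val (reg RM) \<sigma> = m" using assms(1) by (simp add: env_def)
  define I where "I k \<rho> \<longleftrightarrow> env D \<rho> \<and> counted \<rho> \<and> \<rho> HX = \<sigma> HX \<and>
    (\<forall>a<m. ints (\<rho> FX) a = (if a < k then 2 * x a else refined (cap u D) (cap y D) x ?h a))" for k \<rho>
  have "I 0 \<sigma>'"
    unfolding assms(4)
  proof (rule loop_rule[where I = I, OF _ _ _ refl])
    show "CA \<notin> writes ?p"
      by (simp add: push_forw_def incr_def)
    show "I (val (reg RM) \<sigma>) (put CA 0 (val (reg RM) \<sigma>) \<sigma>)"
      unfolding m using assms(1-3) by (simp add: I_def)
    fix k \<rho> assume "k < val (reg RM) \<sigma>" and I: "I (Suc k) \<rho>"
    then have k: "k < m" unfolding m by simp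
    let ?\<rho> = "put CA 0 k \<rho>"
    have e: "env D ?\<rho>" and c: "counted ?\<rho>" and ca: "?\<rho> CA 0 = k" and h: "?\<rho> HX = \<sigma> HX"
      and x: "ints (\<rho> FX) k = 2 * x k"
      using I k by (auto simp: I_def)
    \<comment> \<open>A reduced cost depends on the flow only at its own arc, so pushes made earlier
      in the loop do not matter.\<close>
    have "red_forw (cap y D) (ints (\<rho> FX)) ?h k = red_forw (cap y D) (\<lambda>a. 2 * x a) ?h k"
      using x by (intro red_cong) simp
    then have t: "val (AndE (LessE arc_flow arc_cap) (forw_below 1)) ?\<rho> \<noteq> 0 \<longleftrightarrow>
        2 * x k < cap u D k \<and> red_forw (cap y D) (\<lambda>a. 2 * x a) ?h k < -1"
      using val_forw_below[OF e ca, of 1] x h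
      by (simp add: arc_vals[OF e ca] arc_residual[OF e ca, simplified] not_le)
    note p = push_forw_sem[OF e c ca k]
    show "I k (sem ?p ?\<rho>)"
    proof (cases "2 * x k < cap u D k \<and> red_forw (cap y D) (\<lambda>a. 2 * x a) ?h k < -1")
      case True
      then have "sem ?p ?\<rho> = sem push_forw ?\<rho>" using t by simp
      moreover have "refined (cap u D) (cap y D) x ?h k = 2 * x k + 1"
        using True by (simp add: refined_def)
      ultimately show ?thesis using p I x unfolding I_def by (auto simp: less_Suc_eq)
    next
      case False
      then have "sem ?p ?\<rho> = ?\<rho>" unfolding sem.simps t by (simp only: if_False)
      moreover have "refined (cap u D) (cap y D) x ?h k = 2 * x k"
        using False by (simp add: refined_def)
      ultimately show ?thesis using I unfolding I_def by (auto simp: less_Suc_eq)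
    qed
  qed
  then show "\<And>a. a < m \<Longrightarrow> ints (\<sigma>' FX) a = refined (cap u D) (cap y D) x ?h a"
    "env D \<sigma>'" "counted \<sigma>'" "\<sigma>' HX = \<sigma> HX" by (auto simp: I_def)
qed

lemma eps_opt_cong:
  assumes "\<And>a. a < m \<Longrightarrow> x a = x' a"
  shows "eps_opt U Y x h = eps_opt U Y x' h"
  unfolding eps_opt_def using assms red_cong[of x _ x'] by auto

lemma phase_sem:
  assumes s: "settled (2 * D) R \<sigma>" and R: "0 \<le> R" "R + int n * (int n + 2) \<le> int (L * n * (n + 2))"
  shows "settled D (R + int n * (int n + 2)) (sem phase \<sigma>)"
proof -
  define \<sigma>1 where "\<sigma>1 = put RD 0 (\<sigma> RD 0 div 2) \<sigma>"
  define \<sigma>2 where "\<sigma>2 = sem (For CA RM (dbl FX (reg CA))) \<sigma>1"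
  define \<sigma>3 where "\<sigma>3 = sem (For CV RN (dbl IN (reg CV) ;; dbl OUT (reg CV))) \<sigma>2"
  define \<sigma>4 where "\<sigma>4 = sem (For CA RM (Branch (AndE (LessE arc_flow arc_cap) (forw_below 1)) push_forw Nop)) \<sigma>3"
  have phase: "sem phase \<sigma> = sem discharge \<sigma>4"
    unfolding phase_def sem.simps(3) \<sigma>1_def \<sigma>2_def \<sigma>3_def \<sigma>4_def by simp
  let ?x = "ints (\<sigma> FX)"
  let ?h = "ints (\<sigma> HX)"
  have e1: "env D \<sigma>1" using s by (auto simp: settled_def env_def \<sigma>1_def)
  note s2 = double_flow_sem[OF e1 \<sigma>2_def]
  note s3 = double_excess_sem[OF s2(2) \<sigma>3_def]
  have x3: "ints (\<sigma>3 FX) a = 2 * ?x a" if "a < m" for a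
    using s2(1)[OF that] s3(5) by (simp add: ints_def \<sigma>1_def)
  have "excess (ints (\<sigma>3 FX)) v = 2 * excess ?x v" for v
  proof -
    have "excess (ints (\<sigma>3 FX)) v = excess (\<lambda>a. 2 * ?x a) v"
      by (rule excess_cong[OF x3])
    also have "\<dots> = 2 * excess ?x v"
      by (simp add: excess_def sum_distrib_left mult.left_commute)
    finally show ?thesis .
  qed
  then have c3: "counted \<sigma>3"
    using s s3(1,2) s2(4,5) by (auto simp: counted_def settled_def \<sigma>1_def)
  have "\<forall>a<m. ints (\<sigma>3 FX) a = 2 * ?x a" using x3 by blast
  note s4 = refine_sem[OF s3(3) c3 this \<sigma>4_def]
  have h3: "\<sigma>3 HX = \<sigma> HX" using s3(4) s2(3) by (simp add: \<sigma>1_def)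
  have h4: "\<sigma>4 HX = \<sigma> HX" using s4(4) h3 by simp
  let ?z = "refined (cap u D) (cap y D) ?x ?h"
  have z: "ints (\<sigma>4 FX) a = ?z a" if "a < m" for a
    using s4(1)[OF that] by (simp add: h3)
  \<comment> \<open>Nested division turns the state left by the previous phase into the hypothesis
    of \<open>eps_opt_refined\<close>.\<close>
  have halve: "cap f (2 * D) = (\<lambda>a. cap f D a div 2)" for f
    by (auto simp: cap_def fun_eq_iff mult.commute[of 2] div_mult2_eq zdiv_int)
  have "eps_opt (cap u D) (cap y D) ?z ?h"
    using s unfolding settled_def halve by (intro eps_opt_refined) auto
  then have opt: "eps_opt (cap u D) (cap y D) (ints (\<sigma>4 FX)) (ints (\<sigma>4 HX))"
    unfolding h4 using eps_opt_cong[OF z] by simp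
  have "positive_excess ?z \<le> int m"
    using s by (intro positive_excess_refined) (auto simp: settled_def)
  moreover have "positive_excess (ints (\<sigma>4 FX)) = positive_excess ?z"
    unfolding positive_excess_def using excess_cong[OF z] by simp
  ultimately have "invariant (cap u D) (cap y D) R (ints (\<sigma>4 FX)) (ints (\<sigma>4 HX))"
    using opt s by (auto simp: invariant_def settled_def h4 ints_def intro: add_increasing2)
  then have g: "good D R \<sigma>4"
    using s4 by (simp add: good_def)
  have "good D R (sem phase \<sigma>)" "\<And>v. v < n \<Longrightarrow> excess (ints (sem phase \<sigma> FX)) v = 0"
    unfolding phase using discharge_sem[OF g R(2)] by auto
  then show ?thesis
    by (auto simp: settled_def good_def invariant_def ints_def)
qed

lemma main_loop_sem:
  assumes "settled (2 ^ L) 0 \<sigma>"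
  shows "\<exists>R. settled 1 R (sem main_loop \<sigma>)"
proof -
  have L: "val (reg RL) \<sigma> = L" using assms by (simp add: settled_def env_def)
  have put: "settled D R (put CP i k \<sigma>) = settled D R \<sigma>" for D R i k \<sigma>
    by (simp add: settled_def)
  \<comment> \<open>With \<open>k\<close> phases to come the scaling factor is \<open>2 ^ k\<close>,
    and each of the \<open>L - k\<close> finished phases has added \<open>n * (n + 2)\<close> to the
    height bound.\<close>
  define I where "I k \<rho> \<longleftrightarrow> settled (2 ^ k) (int ((L - k) * n * (n + 2))) \<rho>" for k \<rho>
  have "I 0 (sem main_loop \<sigma>)"
    unfolding main_loop_def
  proof (rule loop_rule[where I = I, OF _ _ _ refl])
    show "CP \<notin> writes phase"
      by (simp add: phase_def discharge_def writes_sweep push_forw_def incr_def dbl_def)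
    show "I (val (reg RL) \<sigma>) (put CP 0 (val (reg RL) \<sigma>) \<sigma>)"
      unfolding L using assms by (simp add: I_def put)
    fix k \<rho> assume "k < val (reg RL) \<sigma>" and I: "I (Suc k) \<rho>"
    then have k: "k < L" unfolding L by simp
    have *: "int ((L - Suc k) * n * (n + 2)) + int n * (int n + 2) = int ((L - k) * n * (n + 2))"
    proof -
      have "L - k = Suc (L - Suc k)" using k by simp
      then show ?thesis by (simp add: algebra_simps)
    qed
    have "settled (2 ^ k) (int ((L - Suc k) * n * (n + 2)) + int n * (int n + 2)) (sem phase (put CP 0 k \<rho>))"
    proof (rule phase_sem)
      show "settled (2 * 2 ^ k) (int ((L - Suc k) * n * (n + 2))) (put CP 0 k \<rho>)"
        using I by (simp add: I_def put)
      show "int ((L - Suc k) * n * (n + 2)) + int n * (int n + 2) \<le> int (L * n * (n + 2))"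
        unfolding * of_nat_le_iff by (intro mult_le_mono1) simp
    qed simp
    then show "I k (sem phase (put CP 0 k \<rho>))"
      unfolding * I_def .
  qed
  then show ?thesis by (auto simp: I_def)
qed

end

section \<open>Reading the input\<close>

primrec loops_over :: "nat set \<Rightarrow> prog \<Rightarrow> bool" where
  "loops_over R Nop = True"
| "loops_over R (Asg a i e) = True"
| "loops_over R (p ;; q) = (loops_over R p \<and> loops_over R q)"
| "loops_over R (Branch e p q) = (loops_over R p \<and> loops_over R q)"
| "loops_over R (Loop halve c e p) = (\<not> halve \<and> (\<exists>r\<in>R. e = reg r) \<and> loops_over R p)"

text \<open>Every loop takes its bound from a register that the program never writes, so the initial
  contents bound all loops, however deeply nested.\<close>

lemma loops_bounded_if_loops_over:
  assumes "loops_over R p" "writes p \<inter> R = {}" "\<forall>r\<in>R. \<sigma> r 0 \<le> B"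
  shows "loops_bounded B p \<sigma>"
  using assms
proof (induction p arbitrary: \<sigma>)
  case (Sq p q)
  have "sem p \<sigma> r = \<sigma> r" if "r \<in> R" for r
    using Sq.prems(2) that by (intro sem_frame) auto
  then show ?case using Sq by (simp add: Int_Un_distrib2)
next
  case (Branch e p q)
  then show ?case by (simp add: Int_Un_distrib2)
next
  case (Loop halve c e p)
  then obtain r where r: "r \<in> R" "e = reg r" "\<not> halve" by auto
  let ?f = "\<lambda>\<sigma>. sem p (tick halve c \<sigma>)"
  have c: "c \<notin> R" and p: "writes p \<inter> R = {}" using Loop.prems(2) by auto
  have tick: "tick halve c \<rho> r = \<rho> r" if "r \<in> R" for \<rho> r
    using that c by (auto simp: tick_def put_def)
  have "(?f ^^ i) (put c 0 k \<sigma>) r = \<sigma> r" if "r \<in> R" for i k r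
  proof (induction i)
    case 0
    then show ?case using that c by (auto simp: put_def)
  next
    case (Suc i)
    have "r \<notin> writes p" using p that by auto
    then show ?case using Suc that by (simp add: sem_frame tick)
  qed
  then have "loops_bounded B p (tick halve c ((?f ^^ i) (put c 0 k \<sigma>)))" for i k
    using Loop.prems p tick by (intro Loop.IH) auto
  then show ?case using r Loop.prems(3) by simp
qed simp_all

text \<open>The start of the \<open>k\<close>-th block of arc data, after the header and the list of
  vertices: \<open>0\<close> tails, \<open>1\<close> heads, \<open>3\<close> scenario capacities,
  \<open>4\<close> nominal flow. Repeated addition replaces a product.\<close>

primrec offset :: "nat \<Rightarrow> expr" where
  "offset 0 = Plus (Const 4) (reg RN)"
| "offset (Suc k) = Plus (offset k) (reg RM)"

definition arc_input :: "nat \<Rightarrow> expr" where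
  "arc_input k = Load 0 (Plus (offset k) (reg CA))"

definition load_end :: "nat \<Rightarrow> nat \<Rightarrow> prog" where
  "load_end r k = Branch (EqE (arc_input k) (Load 0 (Const 3))) (Asg r (reg CA) (Load 0 (Const 2))) (Asg r (reg CA) (arc_input k))"

definition load_arc :: prog where
  "load_arc = load_end TL 0 ;; load_end HD 1 ;; Asg UX (reg CA) (arc_input 3) ;; Asg YX (reg CA) (arc_input 4) ;;
     Asg RS (Const 0) (Plus (reg RS) (arc_input 3))"

definition load_graph :: prog where
  "load_graph = Asg RN (Const 0) (Load 0 (Const 0)) ;; Asg RM (Const 0) (Load 0 (Const 1)) ;; For CA RM load_arc"

text \<open>Halving the total capacity counts its bits in \<open>RL\<close>, while \<open>RD\<close>
  grows to the matching power of two.\<close>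

definition count_bits :: prog where
  "count_bits = Asg RD (Const 0) (Const 1) ;; Loop True CP (reg RS) (dbl RD (Const 0) ;; incr RL (Const 0))"

definition set_bounds :: prog where
  "set_bounds = Asg RN1 (Const 0) (Plus (reg RN) (Const 1)) ;; Asg RQ (Const 0) (Plus (reg RN) (Const 2)) ;;
     Asg RM1 (Const 0) (Plus (reg RM) (Const 1)) ;; Asg RL1 (Const 0) (Plus (reg RL) (Const 1))"

definition solver :: prog where
  "solver = load_graph ;; count_bits ;; set_bounds ;; main_loop"

lemma val_arc_input:
  "val (arc_input k) \<sigma> = \<sigma> 0 (4 + \<sigma> RN 0 + k * \<sigma> RM 0 + \<sigma> CA 0)"
proof -
  have "val (offset k) \<sigma> = 4 + \<sigma> RN 0 + k * \<sigma> RM 0"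
    by (induction k) auto
  then show ?thesis by (simp add: arc_input_def)
qed

text \<open>The sink keeps its number and becomes isolated if it differs from the source, so the
  nodes need no renumbering.\<close>

definition merge :: "nat \<Rightarrow> nat \<Rightarrow> nat \<Rightarrow> nat" where
  "merge s t v = (if v = t then s else v)"

lemma load_graph_sem:
  assumes "\<sigma> 0 0 = n" "\<sigma> 0 1 = m" "\<forall>a>0. \<sigma> a = (\<lambda>_. 0)"
  defines "\<sigma>' \<equiv> sem load_graph \<sigma>"
  shows "\<And>a. a < m \<Longrightarrow> \<sigma>' TL a = merge (\<sigma> 0 2) (\<sigma> 0 3) (\<sigma> 0 (4 + n + a)) \<and> \<sigma>' HD a = merge (\<sigma> 0 2) (\<sigma> 0 3) (\<sigma> 0 (4 + n + m + a)) \<and>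
      \<sigma>' UX a = \<sigma> 0 (4 + n + 3 * m + a) \<and> \<sigma>' YX a = \<sigma> 0 (4 + n + 4 * m + a)"
    and "\<sigma>' RN 0 = n" "\<sigma>' RM 0 = m" "\<sigma>' RS 0 = (\<Sum>a<m. \<sigma> 0 (4 + n + 3 * m + a))"
proof -
  define \<sigma>1 where "\<sigma>1 = put RM 0 m (put RN 0 n \<sigma>)"
  have \<sigma>': "\<sigma>' = sem (For CA RM load_arc) \<sigma>1"
    using assms(1,2) unfolding \<sigma>'_def load_graph_def sem.simps(3) by (simp add: \<sigma>1_def)
  have m: "val (reg RM) \<sigma>1 = m" by (simp add: \<sigma>1_def)
  define I where "I k \<rho> \<longleftrightarrow> \<rho> 0 = \<sigma> 0 \<and> \<rho> RN 0 = n \<and> \<rho> RM 0 = m \<and>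
    (\<forall>a. k \<le> a \<and> a < m \<longrightarrow> \<rho> TL a = merge (\<sigma> 0 2) (\<sigma> 0 3) (\<sigma> 0 (4 + n + a)) \<and> \<rho> HD a = merge (\<sigma> 0 2) (\<sigma> 0 3) (\<sigma> 0 (4 + n + m + a)) \<and>
      \<rho> UX a = \<sigma> 0 (4 + n + 3 * m + a) \<and> \<rho> YX a = \<sigma> 0 (4 + n + 4 * m + a)) \<and>
    \<rho> RS 0 = (\<Sum>a\<in>{k..<m}. \<sigma> 0 (4 + n + 3 * m + a))" for k \<rho>
  have "I 0 \<sigma>'"
    unfolding \<sigma>'
  proof (rule loop_rule[where I = I, OF _ _ _ refl])
    show "CA \<notin> writes load_arc" by (simp add: load_arc_def load_end_def)
    show "I (val (reg RM) \<sigma>1) (put CA 0 (val (reg RM) \<sigma>1) \<sigma>1)"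
      unfolding m using assms(1-3) by (auto simp: I_def \<sigma>1_def)
    fix k \<rho> assume "k < val (reg RM) \<sigma>1" and I: "I (Suc k) \<rho>"
    then have k: "k < m" unfolding m by simp
    have e: "sem (load_end r j) \<rho> = put r (\<rho> CA 0) (merge (\<rho> 0 2) (\<rho> 0 3) (val (arc_input j) \<rho>)) \<rho>" for r j \<rho>
      by (simp add: load_end_def merge_def)
    let ?\<rho> = "put CA 0 k \<rho>"
    have s: "sem load_arc ?\<rho> = put RS 0 (\<rho> RS 0 + \<sigma> 0 (4 + n + 3 * m + k)) (put YX k (\<sigma> 0 (4 + n + 4 * m + k))
      (put UX k (\<sigma> 0 (4 + n + 3 * m + k)) (put HD k (merge (\<sigma> 0 2) (\<sigma> 0 3) (\<sigma> 0 (4 + n + m + k)))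
      (put TL k (merge (\<sigma> 0 2) (\<sigma> 0 3) (\<sigma> 0 (4 + n + k))) ?\<rho>))))"
      using I by (simp add: load_arc_def e val_arc_input merge_def I_def)
    have "{k..<m} = insert k {Suc k..<m}" using k by auto
    then have sum: "(\<Sum>a\<in>{k..<m}. \<sigma> 0 (4 + n + 3 * m + a)) =
        \<sigma> 0 (4 + n + 3 * m + k) + (\<Sum>a\<in>{Suc k..<m}. \<sigma> 0 (4 + n + 3 * m + a))"
      by simp
    have split: "k \<le> a \<longleftrightarrow> a = k \<or> Suc k \<le> a" for a by auto
    show "I k (sem load_arc ?\<rho>)"
      using I unfolding s I_def sum split by auto
  qed
  then show "\<And>a. a < m \<Longrightarrow> \<sigma>' TL a = merge (\<sigma> 0 2) (\<sigma> 0 3) (\<sigma> 0 (4 + n + a)) \<and> \<sigma>' HD a = merge (\<sigma> 0 2) (\<sigma> 0 3) (\<sigma> 0 (4 + n + m + a)) \<and>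
      \<sigma>' UX a = \<sigma> 0 (4 + n + 3 * m + a) \<and> \<sigma>' YX a = \<sigma> 0 (4 + n + 4 * m + a)"
    "\<sigma>' RN 0 = n" "\<sigma>' RM 0 = m" "\<sigma>' RS 0 = (\<Sum>a<m. \<sigma> 0 (4 + n + 3 * m + a))"
    by (auto simp: I_def lessThan_atLeast0)
qed

lemma count_bits_sem:
  assumes "\<sigma> RL 0 = 0"
  shows "sem count_bits \<sigma> RL 0 = floorlog 2 (\<sigma> RS 0)" "sem count_bits \<sigma> RD 0 = 2 ^ floorlog 2 (\<sigma> RS 0)"
proof -
  let ?p = "dbl RD (Const 0) ;; incr RL (Const 0)"
  let ?f = "\<lambda>\<sigma>. sem ?p (tick True CP \<sigma>)"
  have f: "((?f ^^ i) \<rho>) RL 0 = \<rho> RL 0 + i \<and> ((?f ^^ i) \<rho>) RD 0 = 2 ^ i * \<rho> RD 0" for i \<rho>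
    by (induction i) (auto simp: dbl_def incr_def tick_def)
  have "sem count_bits \<sigma> = (?f ^^ floorlog 2 (\<sigma> RS 0)) (put CP 0 (\<sigma> RS 0) (put RD 0 1 \<sigma>))"
    by (simp only: count_bits_def sem.simps val.simps loop_count.simps if_True) simp
  then show "sem count_bits \<sigma> RL 0 = floorlog 2 (\<sigma> RS 0)" "sem count_bits \<sigma> RD 0 = 2 ^ floorlog 2 (\<sigma> RS 0)"
    using f assms by simp_all
qed

lemma writes_solver:
  "writes load_graph = {RN, RM, CA, TL, HD, UX, YX, RS}"
  "writes count_bits = {RD, CP, RL}"
  "writes set_bounds = {RN1, RQ, RM1, RL1}"
  "writes main_loop = {FX, HX, IN, OUT, RD, FL, CA, CV, CP, 22, 23, 24, 25, 26, 27}"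
  by (auto simp: load_graph_def load_arc_def load_end_def count_bits_def set_bounds_def main_loop_def phase_def
      discharge_def sweep_def process_node_def scan_arc_def push_forw_def push_back_def incr_def dbl_def)

lemma set_bounds_sem:
  "sem set_bounds \<sigma> = put RL1 0 (\<sigma> RL 0 + 1) (put RM1 0 (\<sigma> RM 0 + 1)
     (put RQ 0 (\<sigma> RN 0 + 2) (put RN1 0 (\<sigma> RN 0 + 1) \<sigma>)))"
  by (simp add: set_bounds_def)

lemma solver_sem:
  assumes "\<sigma> 0 0 = n" "\<sigma> 0 1 = m" "\<forall>a>0. \<sigma> a = (\<lambda>_. 0)"
    and ends: "0 < n" "\<sigma> 0 2 < n" "\<forall>a<m. \<sigma> 0 (4 + n + a) < n \<and> \<sigma> 0 (4 + n + m + a) < n"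
    and B: "n + 2 \<le> B" "m + 1 \<le> B" "floorlog 2 (\<Sum>a<m. \<sigma> 0 (4 + n + 3 * m + a)) + 1 \<le> B"
  shows "loops_bounded B solver \<sigma>"
    and "\<exists>tl hd u y h. network n m tl hd \<and>
      (\<forall>a<m. tl a = merge (\<sigma> 0 2) (\<sigma> 0 3) (\<sigma> 0 (4 + n + a)) \<and> hd a = merge (\<sigma> 0 2) (\<sigma> 0 3) (\<sigma> 0 (4 + n + m + a)) \<and>
        u a = \<sigma> 0 (4 + n + 3 * m + a) \<and> y a = \<sigma> 0 (4 + n + 4 * m + a)) \<and>
      network.eps_opt n m tl hd (ints u) (ints y) (ints (sem solver \<sigma> FX)) h \<and>
      (\<forall>v<n. network.excess m tl hd (ints (sem solver \<sigma> FX)) v = 0)"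
proof -
  define S where "S = (\<Sum>a<m. \<sigma> 0 (4 + n + 3 * m + a))"
  define L where "L = floorlog 2 S"
  define \<sigma>1 where "\<sigma>1 = sem load_graph \<sigma>"
  define \<sigma>2 where "\<sigma>2 = sem count_bits \<sigma>1"
  define \<sigma>3 where "\<sigma>3 = sem set_bounds \<sigma>2"
  have solver: "sem solver \<sigma> = sem main_loop \<sigma>3"
    by (simp only: solver_def sem.simps(3) \<sigma>1_def \<sigma>2_def \<sigma>3_def)
  note s1 = load_graph_sem[of \<sigma> n m, OF assms(1-3), folded \<sigma>1_def, folded S_def]
  have f1: "\<sigma>1 a = \<sigma> a" if "a \<notin> {RN, RM, CA, TL, HD, UX, YX, RS}" for a
    unfolding \<sigma>1_def using that by (intro sem_frame) (simp add: writes_solver)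
  have f2: "\<sigma>2 a = \<sigma>1 a" if "a \<notin> {RD, CP, RL}" for a
    unfolding \<sigma>2_def using that by (intro sem_frame) (simp add: writes_solver)
  have f3: "\<sigma>3 a = \<sigma>2 a" if "a \<notin> {RN1, RQ, RM1, RL1}" for a
    unfolding \<sigma>3_def using that by (intro sem_frame) (simp add: writes_solver)
  have "\<sigma>1 RL 0 = 0" using f1[of RL] assms(3) by simp
  note s2 = count_bits_sem[of \<sigma>1, OF this, folded \<sigma>2_def, unfolded s1(4), folded L_def]
  have s3: "\<sigma>3 RN 0 = n" "\<sigma>3 RM 0 = m" "\<sigma>3 RL 0 = L" "\<sigma>3 RD 0 = 2 ^ L" "\<sigma>3 RN1 0 = n + 1" "\<sigma>3 RQ 0 = n + 2"
    "\<sigma>3 RM1 0 = m + 1" "\<sigma>3 RL1 0 = L + 1"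
    using s1 s2 f2 by (simp_all add: \<sigma>3_def set_bounds_sem L_def)
  have zero: "\<sigma>3 FX = (\<lambda>_. 0)" "\<sigma>3 HX = (\<lambda>_. 0)" "\<sigma>3 IN = (\<lambda>_. 0)" "\<sigma>3 OUT = (\<lambda>_. 0)"
    using assms(3) by (simp_all add: f1 f2 f3)
  have arcs: "\<sigma>3 TL = \<sigma>1 TL" "\<sigma>3 HD = \<sigma>1 HD" "\<sigma>3 UX = \<sigma>1 UX" "\<sigma>3 YX = \<sigma>1 YX"
    by (simp_all add: f2 f3)
  have L: "L + 1 \<le> B" using B(3) by (simp add: L_def S_def)

  have "loops_bounded B load_graph \<sigma>"
    unfolding load_graph_def loops_bounded.simps(2,3)
    using assms(1,2) B(2)
    by (simp del: loops_bounded.simps)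
      (rule loops_bounded_if_loops_over[of "{RM}"]; simp add: load_arc_def load_end_def)
  moreover have "loops_bounded B count_bits \<sigma>1"
    using s1(4) L by (simp add: count_bits_def dbl_def incr_def L_def)
  moreover have "loops_bounded B set_bounds \<sigma>2"
    by (simp add: set_bounds_def)
  moreover have "loops_bounded B main_loop \<sigma>3"
  proof (rule loops_bounded_if_loops_over[of "{RN, RM, RL, RQ, RM1, RL1}"])
    show "loops_over {RN, RM, RL, RQ, RM1, RL1} main_loop"
      by (simp add: main_loop_def phase_def discharge_def sweep_def process_node_def scan_arc_def
          push_forw_def push_back_def incr_def dbl_def)
    show "writes main_loop \<inter> {RN, RM, RL, RQ, RM1, RL1} = {}"
      by (simp add: writes_solver)
    show "\<forall>r\<in>{RN, RM, RL, RQ, RM1, RL1}. \<sigma>3 r 0 \<le> B"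
      using s3 B L by simp
  qed
  ultimately show "loops_bounded B solver \<sigma>"
    by (simp only: solver_def loops_bounded.simps(3) \<sigma>1_def \<sigma>2_def \<sigma>3_def)

  define tl hd u y where "tl = \<sigma>1 TL" and "hd = \<sigma>1 HD" and "u = \<sigma>1 UX" and "y = \<sigma>1 YX"
  have tl: "tl a < n" "hd a < n" if "a < m" for a
    using s1(1)[OF that] ends(2,3) that by (auto simp: tl_def hd_def merge_def)
  interpret flow_program n m tl hd u y L
    by unfold_locales (use tl ends(1) in auto)
  \<comment> \<open>\<open>2 ^ L\<close> exceeds the total capacity, so no arc is residual and the
    zero flow satisfies \<open>eps_opt\<close> whatever the nominal flow is.\<close>
  have u: "cap u (2 ^ L) a = 0" if "a < m" for a
  proof -
    have "u a \<le> S" unfolding S_def using s1(1)[OF that] that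
      by (auto simp: u_def intro: member_le_sum)
    also have "S < 2 ^ L" unfolding L_def by (rule floorlog_leD) auto
    finally show ?thesis by (simp add: cap_def)
  qed
  have "env (2 ^ L) \<sigma>3"
    using s3 arcs unfolding env_def by (simp add: tl_def hd_def u_def y_def)
  then have "settled (2 ^ L) 0 \<sigma>3"
    using u zero unfolding settled_def counted_def excess_def eps_opt_def by (simp add: ints_def)
  then obtain R where "settled 1 R (sem main_loop \<sigma>3)"
    using main_loop_sem by blast
  moreover have "cap f 1 = ints f" for f
    by (auto simp: cap_def ints_def)
  ultimately have "eps_opt (ints u) (ints y) (ints (sem solver \<sigma> FX)) (ints (sem solver \<sigma> HX))"
    "\<forall>v<n. excess (ints (sem solver \<sigma> FX)) v = 0"
    by (simp_all add: settled_def solver)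
  moreover have "\<forall>a<m. tl a = merge (\<sigma> 0 2) (\<sigma> 0 3) (\<sigma> 0 (4 + n + a)) \<and> hd a = merge (\<sigma> 0 2) (\<sigma> 0 3) (\<sigma> 0 (4 + n + m + a)) \<and>
        u a = \<sigma> 0 (4 + n + 3 * m + a) \<and> y a = \<sigma> 0 (4 + n + 4 * m + a)"
    using s1(1) by (simp add: tl_def hd_def u_def y_def)
  ultimately show "\<exists>tl hd u y h. network n m tl hd \<and>
      (\<forall>a<m. tl a = merge (\<sigma> 0 2) (\<sigma> 0 3) (\<sigma> 0 (4 + n + a)) \<and> hd a = merge (\<sigma> 0 2) (\<sigma> 0 3) (\<sigma> 0 (4 + n + m + a)) \<and>
        u a = \<sigma> 0 (4 + n + 3 * m + a) \<and> y a = \<sigma> 0 (4 + n + 4 * m + a)) \<and>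
      network.eps_opt n m tl hd (ints u) (ints y) (ints (sem solver \<sigma> FX)) h \<and>
      (\<forall>v<n. network.excess m tl hd (ints (sem solver \<sigma> FX)) v = 0)"
    using network_axioms by blast
qed

section \<open>Input size and the reduction to circulations\<close>

lemma linear_offset: "linear_expr (offset k)" and growth_offset: "growth (offset k) = 8 + 3 * k"
  by (induction k) auto

text \<open>\<open>1000\<close> is a generous bound on the growth of the expressions in the program;
  it enters the running time only as a constant.\<close>

lemma well_formed_solver: "well_formed 1000 solver"
  by (simp add: solver_def writes_solver load_graph_def load_arc_def load_end_def arc_input_def
      count_bits_def set_bounds_def main_loop_def phase_def
      discharge_def sweep_def process_node_def scan_arc_def push_forw_def push_back_def incr_def dbl_def
      forw_below_def back_below_def arc_tl_def arc_hd_def arc_flow_def arc_cap_def arc_nom_def active_def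
      linear_offset growth_offset)

lemma length_le_input_size: "length xs \<le> input_size xs"
  by (induction xs) (auto simp: input_size_def bits_def)

text \<open>A sum needs no more bits than its summands together. So the number of phases, taken from
  the total capacity, is at most the input size.\<close>

lemma sum_list_less: "sum_list xs < 2 ^ input_size xs"
proof (induction xs)
  case (Cons x xs)
  have "x + sum_list xs < 2 ^ (bits x + input_size xs)"
    using less_bits Cons by (rule add_less_two_power)
  then show ?case by (simp add: input_size_def)
qed (simp add: input_size_def)

lemma init_store_less: "init_store xs a i < 2 ^ input_size xs"
proof (cases "a = 0 \<and> i < length xs")
  case True
  then have "xs ! i \<le> sum_list xs" by (intro member_le_sum_list) auto
  then show ?thesis using sum_list_less[of xs] True by (simp add: init_store_def)
qed (auto simp: init_store_def)

lemma encode_MF_nth: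
  fixes I
  defines "n \<equiv> card (verts (graph I))" and "m \<equiv> card (arcs (graph I))"
  shows "encode_MF I ! 0 = n" "encode_MF I ! 1 = m" "encode_MF I ! 2 = src I" "encode_MF I ! 3 = snk I"
    and "\<And>a. a < m \<Longrightarrow> encode_MF I ! (4 + n + a) = tail (graph I) a"
    and "\<And>a. a < m \<Longrightarrow> encode_MF I ! (4 + n + m + a) = head (graph I) a"
    and "\<And>a. a < m \<Longrightarrow> encode_MF I ! (4 + n + 3 * m + a) = scen_cap I a"
    and "\<And>a. a < m \<Longrightarrow> encode_MF I ! (4 + n + 4 * m + a) = nat (nom_sol I a)"
    and "length (encode_MF I) = 4 + n + 5 * m"
  by (simp_all add: encode_MF_def Let_def n_def[symmetric] m_def[symmetric] nth_append numeral_eq_Suc)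

lemma excess_arcs:
  fixes G :: "('v, nat) pre_digraph"
  assumes "arcs G = {..<m}"
  shows "(\<Sum>a\<in>in_arcs G v. z a) - (\<Sum>a\<in>out_arcs G v. z a) =
    (\<Sum>a<m. (of_bool (head G a = v) - of_bool (tail G a = v)) * (z a :: int))"
proof -
  have "(\<Sum>a\<in>in_arcs G v. z a) = (\<Sum>a<m. of_bool (head G a = v) * z a)"
    by (intro sum.mono_neutral_cong_left) (auto simp: in_arcs_def assms)
  moreover have "(\<Sum>a\<in>out_arcs G v. z a) = (\<Sum>a<m. of_bool (tail G a = v) * z a)"
    by (intro sum.mono_neutral_cong_left) (auto simp: out_arcs_def assms)
  ultimately show ?thesis
    by (simp add: sum_subtractf left_diff_distrib del: sum_of_bool_mult_eq)
qed

text \<open>A flow need not be balanced at source and sink. After their identification the balance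
  at the common node follows from the others, since all excesses sum to zero, so feasible flows and
  circulations are the same vectors.\<close>

lemma optimal_reaction_if_eps_opt:
  fixes I and tl hd :: "nat \<Rightarrow> nat"
  defines "n \<equiv> card (verts (graph I))" and "m \<equiv> card (arcs (graph I))"
  assumes I: "I \<in> MF_instances"
    and net: "network n m tl hd" and ends: "\<And>a. a < m \<Longrightarrow>
      tl a = merge (src I) (snk I) (tail (graph I) a) \<and> hd a = merge (src I) (snk I) (head (graph I) a)"
    and caps: "\<And>a. a < m \<Longrightarrow> u a = int (scen_cap I a) \<and> y a = nom_sol I a"
    and opt: "network.eps_opt n m tl hd u y x h" and x: "\<forall>v<n. network.excess m tl hd x v = 0"
  shows "optimal_reaction I x"
proof -
  interpret network n m tl hd by fact
  let ?G = "graph I"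
  let ?s = "src I"
  let ?t = "snk I"
  have verts: "verts ?G = {..<n}" and arcs: "arcs ?G = {..<m}" and st: "?s < n" "?t < n"
    using I by (auto simp: MF_instances_def n_def m_def)
  have excess_eq: "excess z v = (\<Sum>a\<in>in_arcs ?G v. z a) - (\<Sum>a\<in>out_arcs ?G v. z a)"
    if "v \<noteq> ?s" "v \<noteq> ?t" for z v
    unfolding excess_arcs[OF arcs] excess_def
    using that ends by (intro sum.cong) (auto simp: merge_def)
  have "(\<Sum>a\<in>in_arcs ?G v. x a) = (\<Sum>a\<in>out_arcs ?G v. x a)" if "v < n" "v \<noteq> ?s" "v \<noteq> ?t" for v
    using excess_eq[OF that(2,3), of x] x that(1) by simp
  then have "x \<in> feasible_flows ?G ?s ?t (scen_cap I)"
    using opt caps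
    by (auto simp: feasible_flows_def verts arcs eps_opt_def)
  moreover have "d_val ?G x (nom_sol I) \<le> d_val ?G z (nom_sol I)"
    if "z \<in> feasible_flows ?G ?s ?t (scen_cap I)" for z
  proof -
    have z: "0 \<le> z a \<and> z a \<le> u a" if "a < m" for a
      using \<open>z \<in> _\<close> that caps by (auto simp: feasible_flows_def arcs)
    have other: "excess z v = 0" if "v < n" "v \<noteq> ?s" for v
    proof (cases "v = ?t")
      case True
      then have "excess z v = (\<Sum>a<m. 0)"
        unfolding excess_def using ends that(2) by (intro sum.cong) (auto simp: merge_def)
      then show ?thesis by simp
    next
      case False
      then show ?thesis
        using \<open>z \<in> _\<close> that excess_eq[of v z] by (simp add: feasible_flows_def verts)
    qed
    have "(\<Sum>v<n. excess z v) = 0"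
      using sum_excess[of "\<lambda>_. 1" z] by simp
    moreover have "(\<Sum>v<n. excess z v) = excess z ?s"
      using st(1) other by (subst sum.remove[of _ ?s]) auto
    ultimately have "excess z v = 0" if "v < n" for v
      using other that by (cases "v = ?s") auto
    then have "(\<Sum>a<m. \<bar>x a - y a\<bar>) \<le> (\<Sum>a<m. \<bar>z a - y a\<bar>)"
      using x z by (intro eps_opt_imp_optimal[OF opt]) auto
    then show ?thesis
      using caps by (simp add: d_val_def arcs)
  qed
  ultimately show ?thesis
    unfolding optimal_reaction_def is_arg_min_def by (auto simp: not_less)
qed

lemma solver_correct:
  fixes I
  defines "s \<equiv> input_size (encode_MF I)"
  assumes I: "I \<in> MF_instances"
  shows "loops_bounded (s + 2) solver (init_store (encode_MF I))"
    and "optimal_reaction I (\<lambda>a. int (sem solver (init_store (encode_MF I)) 1 a))"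
proof -
  define n where "n = card (verts (graph I))"
  define m where "m = card (arcs (graph I))"
  define \<sigma> where "\<sigma> = init_store (encode_MF I)"
  interpret fin_digraph "graph I" using I by (simp add: MF_instances_def)
  have verts: "verts (graph I) = {..<n}" and arcs: "arcs (graph I) = {..<m}"
    and st: "src I < n" "snk I < n"
    using I by (auto simp: MF_instances_def n_def m_def)
  have ends: "tail (graph I) a < n" "head (graph I) a < n" if "a < m" for a
    using that tail_in_verts[of a] head_in_verts[of a] by (auto simp: verts arcs)
  \<comment> \<open>The input holds \<open>nat (nom_sol I a)\<close>, which loses nothing because
    the nominal flow is nonnegative.\<close>
  have nom: "0 \<le> nom_sol I a" if "a < m" for a
    using I that arcs by (auto simp: MF_instances_def feasible_flows_def)
  note enc = encode_MF_nth[where I = I, folded n_def m_def]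
  have \<sigma>: "\<sigma> 0 i = encode_MF I ! i" if "i < 4 + n + 5 * m" for i
    using that enc(9) by (simp add: \<sigma>_def init_store_def)
  have input: "\<sigma> 0 0 = n" "\<sigma> 0 1 = m" "\<sigma> 0 2 = src I" "\<sigma> 0 3 = snk I"
    using \<sigma> enc(1-4) by auto
  have arc: "\<sigma> 0 (4 + n + a) = tail (graph I) a" "\<sigma> 0 (4 + n + m + a) = head (graph I) a"
    "\<sigma> 0 (4 + n + 3 * m + a) = scen_cap I a" "\<sigma> 0 (4 + n + 4 * m + a) = nat (nom_sol I a)" if "a < m" for a
    using \<sigma>[of "4 + n + a"] \<sigma>[of "4 + n + m + a"] \<sigma>[of "4 + n + 3 * m + a"] \<sigma>[of "4 + n + 4 * m + a"]
      enc(5-8)[OF that] that by simp_all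
  have zero: "\<forall>a>0. \<sigma> a = (\<lambda>_. 0)"
    by (auto simp: \<sigma>_def init_store_def)
  have size: "4 + n + 5 * m \<le> s"
    using length_le_input_size[of "encode_MF I"] enc(9) by (simp add: s_def)
  have "(\<Sum>a<m. \<sigma> 0 (4 + n + 3 * m + a)) = sum_list (map (scen_cap I) [0..<m])"
    using arc(3) by (simp add: interv_sum_list_conv_sum_set_nat lessThan_atLeast0)
  also have "\<dots> \<le> sum_list (encode_MF I)"
    by (simp add: encode_MF_def Let_def n_def m_def)
  also have "\<dots> < 2 ^ s"
    unfolding s_def by (rule sum_list_less)
  finally have "floorlog 2 (\<Sum>a<m. \<sigma> 0 (4 + n + 3 * m + a)) \<le> s"
    by (intro floorlog_leI) auto
  then have B: "n + 2 \<le> s + 2" "m + 1 \<le> s + 2" "floorlog 2 (\<Sum>a<m. \<sigma> 0 (4 + n + 3 * m + a)) + 1 \<le> s + 2"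
    using size by auto
  have n: "0 < n" "\<sigma> 0 2 < n" "\<forall>a<m. \<sigma> 0 (4 + n + a) < n \<and> \<sigma> 0 (4 + n + m + a) < n"
    using st input ends arc by auto
  note solver = solver_sem[of \<sigma> n m, OF input(1,2) zero n B]
  show "loops_bounded (s + 2) solver (init_store (encode_MF I))"
    using solver(1) by (simp add: \<sigma>_def)
  obtain tl hd u y h where net: "network n m tl hd"
    and eq: "\<And>a. a < m \<Longrightarrow> tl a = merge (\<sigma> 0 2) (\<sigma> 0 3) (\<sigma> 0 (4 + n + a)) \<and> hd a = merge (\<sigma> 0 2) (\<sigma> 0 3) (\<sigma> 0 (4 + n + m + a)) \<and>
      u a = \<sigma> 0 (4 + n + 3 * m + a) \<and> y a = \<sigma> 0 (4 + n + 4 * m + a)"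
    and opt: "network.eps_opt n m tl hd (ints u) (ints y) (ints (sem solver \<sigma> FX)) h"
    and x: "\<forall>v<n. network.excess m tl hd (ints (sem solver \<sigma> FX)) v = 0"
    using solver(2) by blast
  have "optimal_reaction I (ints (sem solver \<sigma> FX))"
  proof (rule optimal_reaction_if_eps_opt[OF I, folded n_def m_def])
    show "tl a = merge (src I) (snk I) (tail (graph I) a) \<and> hd a = merge (src I) (snk I) (head (graph I) a)"
      if "a < m" for a
      using eq[OF that] arc[OF that] input by simp
    show "ints u a = int (scen_cap I a) \<and> ints y a = nom_sol I a" if "a < m" for a
      using eq[OF that] arc[OF that] nom[OF that] by (simp add: ints_def)
  qed fact+
  then show "optimal_reaction I (\<lambda>a. int (sem solver (init_store (encode_MF I)) 1 a))"
    by (simp add: ints_def[abs_def] \<sigma>_def)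
qed

theorem mainTheorem7:
  shows "polynomial_time_solvable MF_instances encode_MF
           (\<lambda>I y. optimal_reaction I (\<lambda>a. int (y a)))"
proof -
  \<comment> \<open>For input size \<open>s\<close>, \<open>k\<close> is the number of steps with
    loop bound \<open>s + 2\<close>, and \<open>p\<close> is
    \<open>k * step_cost 1000 (s + 1000 * k)\<close> as a polynomial in \<open>s\<close>, the memory
    initially holding numbers below \<open>2 ^ s\<close>.\<close>
  define k where "k = pcompose (steps solver) [:2, 1:]"
  define p where "p = k * (1 + smult 2000 ([:0, 1:] + smult 1000 k))"
  have "\<exists>\<tau> \<sigma>. exec (compile solver) (init_store (encode_MF I)) \<tau> \<sigma> \<and>
      \<tau> \<le> poly p (input_size (encode_MF I)) \<and> optimal_reaction I (\<lambda>a. int (\<sigma> 1 a))"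
    if I: "I \<in> MF_instances" for I
  proof -
    let ?\<sigma> = "init_store (encode_MF I)"
    let ?s = "input_size (encode_MF I)"
    have "runs 1000 ?s (compile solver) ?\<sigma> (poly (steps solver) (?s + 2)) (sem solver ?\<sigma>)"
      using init_store_less by (intro runs_compile well_formed_solver solver_correct(1)[OF I]) auto
    moreover have "poly (steps solver) (?s + 2) = poly k ?s"
      by (simp add: k_def poly_pcompose add.commute)
    ultimately obtain \<tau> where "exec (compile solver) ?\<sigma> \<tau> (sem solver ?\<sigma>)"
      "\<tau> \<le> poly k ?s * step_cost 1000 (?s + 1000 * poly k ?s)"
      by (auto simp: runs_def)
    moreover have "poly k ?s * step_cost 1000 (?s + 1000 * poly k ?s) = poly p ?s"
      by (simp add: p_def step_cost_def)
    ultimately show ?thesis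
      using solver_correct(2)[OF I] by auto
  qed
  then show ?thesis
    unfolding polynomial_time_solvable_def by blast
qed

end
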